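(* Let $A=(a_{ij})_{i,j=1}^n$ be a generalized Cartan matrix, let $\mathfrak{g}(A)$ be the associated Kac-Moody algebra over $\mathbb{C}$, and let $\mathfrak{b}^+,\mathfrak{b}^-$ be its Borel subalgebras. For every integer $N\ge3$, $$\mathrm{Der}^{(N)}(\mathfrak{g}(A))=\mathrm{Der}(\mathfrak{g}(A)),\qquad \mathrm{Der}^{(N)}(\mathfrak{b}^{\pm})=\mathrm{Der}(\mathfrak{b}^{\pm}).$$
   Context: A matrix $A=(a_{ij})_{i,j=1}^n$ is a generalized Cartan matrix if $a_{ii}=2$ for all $i$, $a_{ij}$ is a nonpositive integer for $i\ne j$, and $a_{ij}=0$ implies $a_{ji}=0$. Let $l$ be the rank of $A$. A realization of $A$ is a triple $(\mathfrak{h},\Pi,\Pi^\vee)$ where $\mathfrak{h}$ is a complex vector space of dimension $2n-l$, and $\Pi=\{\alpha_1,\dots,\alpha_n\}\subset\mathfrak{h}^*$ and $\Pi^\vee=\{\alpha_1^\vee,\dots,\alpha_n^\vee\}\subset\mathfrak{h}$ are linearly independent subsets with $\alpha_j(\alpha_i^\vee)=a_{ij}$ for all $i,j$. The Kac-Moody algebra $\mathfrak{g}(A)$ is the complex Lie algebra generated by $\mathfrak{h},e_1,\dots,e_n,f_1,\dots,f_n$ with defining relations $$[e_i,f_j]=\delta_{ij}\alpha_i^\vee,\quad [h,h']=0,\quad [h,e_i]=\alpha_i(h)e_i,\quad [h,f_i]=-\alpha_i(h)f_i\qquad(i,j=1,\dots,n;\ h,h'\in\mathfrak{h}),$$ $$(\mathrm{ad}\,e_i)^{1-a_{ij}}e_j=(\mathrm{ad}\,f_i)^{1-a_{ij}}f_j=0\qquad(i\ne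 j).$$ For $\alpha\in\mathfrak{h}^*$ put $\mathfrak{g}_\alpha=\{x\in\mathfrak{g}(A)\mid[h,x]=\alpha(h)x\text{ for all }h\in\mathfrak{h}\}$ (so $\mathfrak{g}_0=\mathfrak{h}$). Let $Q^+=\sum_{i=1}^n\mathbb{N}\alpha_i$ with $0\in\mathbb{N}$. The Borel subalgebras are $\mathfrak{b}^{\pm}=\bigoplus_{\alpha\in Q^+}\mathfrak{g}_{\pm\alpha}$. For elements of a Lie algebra $\mathcal{L}$ write $[x_1,\dots,x_N]=[x_1,[x_2,\cdots[x_{N-2},[x_{N-1},x_N]]\cdots]]$. An $N$-derivation of $\mathcal{L}$ is a linear map $\varphi:\mathcal{L}\to\mathcal{L}$ with $\varphi([x_1,\dots,x_N])=\sum_{i=1}^N[x_1,\dots,x_{i-1},\varphi(x_i),x_{i+1},\dots,x_N]$ for all $x_1,\dots,x_N\in\mathcal{L}$; $\mathrm{Der}^{(N)}(\mathcal{L})$ is the set of all $N$-derivations and $\mathrm{Der}(\mathcal{L})$ the set of all derivations of $\mathcal{L}$. *)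

theory Defs
  imports "HOL-Analysis.Analysis" "HOL-Library.Function_Algebras"
begin

section \<open>Lie algebras, derivations and N-derivations\<close>

locale lie_algebra = vector_space scale
  for scale :: "complex \<Rightarrow> 'g::ab_group_add \<Rightarrow> 'g" (infixr \<open>\<odot>\<close> 75) +
  fixes bracket :: "'g \<Rightarrow> 'g \<Rightarrow> 'g"
  assumes linear_bracket_right: "Vector_Spaces.linear scale scale (\<lambda>y. bracket x y)"
    and linear_bracket_left: "Vector_Spaces.linear scale scale (\<lambda>x. bracket x y)"
    and bracket_self: "bracket x x = 0"
    and bracket_jacobi: "bracket x (bracket y z) + bracket y (bracket z x) + bracket z (bracket x y) = 0"
begin

text \<open>The right-normed bracket \<open>[x\<^sub>1,[x\<^sub>2,\<dots>[x\<^sub>N\<^sub>-\<^sub>1,x\<^sub>N]\<dots>]]\<close>; the value on the empty list is never used.\<close>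

fun nested_bracket :: "'g list \<Rightarrow> 'g" where
  "nested_bracket [] = 0"
| "nested_bracket [x] = x"
| "nested_bracket (x # y # zs) = bracket x (nested_bracket (y # zs))"

text \<open>Below, \<open>L\<close> is meant to be a Lie subalgebra. An endomorphism of \<open>L\<close> is represented by the
  function on the ambient type which is \<open>undefined\<close> outside \<open>L\<close>, so that equality of
  functions is equality of maps \<open>L \<rightarrow> L\<close>.\<close>

definition linear_endos :: "'g set \<Rightarrow> ('g \<Rightarrow> 'g) set" where
  "linear_endos L = {\<phi> \<in> L \<rightarrow>\<^sub>E L.
     (\<forall>x\<in>L. \<forall>y\<in>L. \<phi> (x + y) = \<phi> x + \<phi> y) \<and> (\<forall>c. \<forall>x\<in>L. \<phi> (c \<odot> x) = c \<odot> \<phi> x)}"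

definition derivations :: "'g set \<Rightarrow> ('g \<Rightarrow> 'g) set" where
  "derivations L = {\<phi> \<in> linear_endos L.
     \<forall>x\<in>L. \<forall>y\<in>L. \<phi> (bracket x y) = bracket (\<phi> x) y + bracket x (\<phi> y)}"

definition N_derivations :: "nat \<Rightarrow> 'g set \<Rightarrow> ('g \<Rightarrow> 'g) set" where
  "N_derivations N L = {\<phi> \<in> linear_endos L.
     \<forall>xs. length xs = N \<and> set xs \<subseteq> L \<longrightarrow>
       \<phi> (nested_bracket xs) = (\<Sum>i<N. nested_bracket (xs[i := \<phi> (xs ! i)]))}"

end

section \<open>Lie algebras given by generators and relations\<close>

datatype 'x lie_word =
    Gen 'x
  | Zero
  | Add "'x lie_word" "'x lie_word"
  | Scale complex "'x lie_word"
  | Bracket "'x lie_word" "'x lie_word"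

text \<open>The congruence on words generated by the complex Lie algebra axioms and the relations
  \<open>R\<close>; its classes form the Lie algebra presented by the generators \<open>'x\<close> and the relations \<open>R\<close>.\<close>

inductive lie_cong :: "('x lie_word \<Rightarrow> 'x lie_word \<Rightarrow> bool) \<Rightarrow> 'x lie_word \<Rightarrow> 'x lie_word \<Rightarrow> bool"
  for R where
  rel: "R s t \<Longrightarrow> lie_cong R s t"
| refl: "lie_cong R s s"
| sym: "lie_cong R s t \<Longrightarrow> lie_cong R t s"
| trans: "lie_cong R s t \<Longrightarrow> lie_cong R t u \<Longrightarrow> lie_cong R s u"
| cong_add: "lie_cong R s s' \<Longrightarrow> lie_cong R t t' \<Longrightarrow> lie_cong R (Add s t) (Add s' t')"
| cong_scale: "lie_cong R s s' \<Longrightarrow> lie_cong R (Scale c s) (Scale c s')"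
| cong_bracket: "lie_cong R s s' \<Longrightarrow> lie_cong R t t' \<Longrightarrow> lie_cong R (Bracket s t) (Bracket s' t')"
| add_assoc: "lie_cong R (Add (Add s t) u) (Add s (Add t u))"
| add_commute: "lie_cong R (Add s t) (Add t s)"
| add_zero: "lie_cong R (Add Zero s) s"
| add_neg: "lie_cong R (Add s (Scale (-1) s)) Zero"
| scale_add_right: "lie_cong R (Scale c (Add s t)) (Add (Scale c s) (Scale c t))"
| scale_add_left: "lie_cong R (Scale (c + d) s) (Add (Scale c s) (Scale d s))"
| scale_scale: "lie_cong R (Scale c (Scale d s)) (Scale (c * d) s)"
| scale_one: "lie_cong R (Scale 1 s) s"
| bracket_add_left: "lie_cong R (Bracket (Add s t) u) (Add (Bracket s u) (Bracket t u))"
| bracket_add_right: "lie_cong R (Bracket u (Add s t)) (Add (Bracket u s) (Bracket u t))"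
| bracket_scale_left: "lie_cong R (Bracket (Scale c s) t) (Scale c (Bracket s t))"
| bracket_scale_right: "lie_cong R (Bracket s (Scale c t)) (Scale c (Bracket s t))"
| bracket_self: "lie_cong R (Bracket s s) Zero"
| jacobi: "lie_cong R (Add (Add (Bracket s (Bracket t u)) (Bracket t (Bracket u s)))
                           (Bracket u (Bracket s t))) Zero"

context lie_algebra
begin

primrec eval_word :: "('x \<Rightarrow> 'g) \<Rightarrow> 'x lie_word \<Rightarrow> 'g" where
  "eval_word \<gamma> (Gen x) = \<gamma> x"
| "eval_word \<gamma> Zero = 0"
| "eval_word \<gamma> (Add s t) = eval_word \<gamma> s + eval_word \<gamma> t"
| "eval_word \<gamma> (Scale c s) = c \<odot> eval_word \<gamma> s"
| "eval_word \<gamma> (Bracket s t) = bracket (eval_word \<gamma> s) (eval_word \<gamma> t)"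

text \<open>\<open>\<gamma>\<close> induces an isomorphism from the Lie algebra presented by \<open>'x\<close> and \<open>R\<close> onto the
  whole Lie algebra: surjectivity says that the \<open>\<gamma> x\<close> generate, the equivalence that \<open>R\<close> is a
  system of defining relations.\<close>

definition presented_by :: "('x \<Rightarrow> 'g) \<Rightarrow> ('x lie_word \<Rightarrow> 'x lie_word \<Rightarrow> bool) \<Rightarrow> bool" where
  "presented_by \<gamma> R \<longleftrightarrow>
     surj (eval_word \<gamma>) \<and> (\<forall>s t. eval_word \<gamma> s = eval_word \<gamma> t \<longleftrightarrow> lie_cong R s t)"

lemma eval_word_lie_cong:
  assumes "lie_cong R s t" and "\<And>u v. R u v \<Longrightarrow> eval_word \<gamma> u = eval_word \<gamma> v"
  shows "eval_word \<gamma> s = eval_word \<gamma> t"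
  using assms(1)
proof (induction rule: lie_cong.induct)
  case (add_neg s)
  then show ?case by simp
next
  case (bracket_add_left s t u)
  then show ?case using linear_bracket_left by (simp add: Vector_Spaces.linear_iff)
next
  case (bracket_add_right u s t)
  then show ?case using linear_bracket_right by (simp add: Vector_Spaces.linear_iff)
next
  case (bracket_scale_left c s t)
  then show ?case using linear_bracket_left by (simp add: Vector_Spaces.linear_iff)
next
  case (bracket_scale_right s c t)
  then show ?case using linear_bracket_right by (simp add: Vector_Spaces.linear_iff)
next
  case (jacobi s t u)
  then show ?case by (simp add: bracket_jacobi)
qed (simp_all add: assms(2) bracket_self scale_right_distrib scale_left_distrib add_ac)

end

section \<open>Generalized Cartan matrices and realizations\<close>

definition generalized_cartan_matrix :: "int^'i^'i \<Rightarrow> bool" where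
  "generalized_cartan_matrix A \<longleftrightarrow>
     (\<forall>i. A $ i $ i = 2) \<and>
     (\<forall>i j. i \<noteq> j \<longrightarrow> A $ i $ j \<le> 0) \<and>
     (\<forall>i j. A $ i $ j = 0 \<longrightarrow> A $ j $ i = 0)"

text \<open>\<open>dim\<close> is \<open>0\<close> on infinite-dimensional spaces; as \<open>2n - l \<ge> n > 0\<close>, the dimension condition
  forces \<open>'h\<close> to be finite-dimensional. The dual of \<open>'h\<close> is a subspace of the functions
  \<open>'h \<Rightarrow> complex\<close>, with their pointwise vector space structure.\<close>

locale realization = vector_space scaleh
  for A :: "int^'i::finite^'i"
    and scaleh :: "complex \<Rightarrow> 'h::ab_group_add \<Rightarrow> 'h" +
  fixes root :: "'i \<Rightarrow> 'h \<Rightarrow> complex"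
    and coroot :: "'i \<Rightarrow> 'h"
  assumes dim_realization:
      "dim UNIV = 2 * CARD('i) - rank ((\<chi> i j. of_int (A $ i $ j)) :: complex^'i^'i)"
    and linear_root: "Vector_Spaces.linear scaleh (*) (root i)"
    and inj_root: "inj root"
    and independent_roots:
      "\<not> module.dependent (\<lambda>(c::complex) (f::'h \<Rightarrow> complex) h. c * f h) (range root)"
    and inj_coroot: "inj coroot"
    and independent_coroots: "independent (range coroot)"
    and root_coroot: "root j (coroot i) = of_int (A $ i $ j)"

lemma vector_space_functions: "vector_space (\<lambda>(c::complex) (f::'h \<Rightarrow> complex) h. c * f h)"
  by unfold_locales (auto simp: fun_eq_iff algebra_simps)

section \<open>Kac-Moody algebras and their Borel subalgebras\<close>

datatype ('h, 'i) km_generator = H 'h | E 'i | F 'i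

text \<open>The first two rules express that \<open>'h\<close> enters the presentation as a vector space, i.e.
  that \<open>h \<mapsto> Gen (H h)\<close> is linear.\<close>

inductive km_relation ::
    "int^'i::finite^'i \<Rightarrow> (complex \<Rightarrow> 'h::ab_group_add \<Rightarrow> 'h) \<Rightarrow> ('i \<Rightarrow> 'h \<Rightarrow> complex) \<Rightarrow> ('i \<Rightarrow> 'h) \<Rightarrow>
     ('h, 'i) km_generator lie_word \<Rightarrow> ('h, 'i) km_generator lie_word \<Rightarrow> bool"
  for A scaleh root coroot where
  H_add: "km_relation A scaleh root coroot (Gen (H (h + h'))) (Add (Gen (H h)) (Gen (H h')))"
| H_scale: "km_relation A scaleh root coroot (Gen (H (scaleh c h))) (Scale c (Gen (H h)))"
| EF_same: "km_relation A scaleh root coroot (Bracket (Gen (E i)) (Gen (F i))) (Gen (H (coroot i)))"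
| EF_diff: "i \<noteq> j \<Longrightarrow> km_relation A scaleh root coroot (Bracket (Gen (E i)) (Gen (F j))) Zero"
| HH: "km_relation A scaleh root coroot (Bracket (Gen (H h)) (Gen (H h'))) Zero"
| HE: "km_relation A scaleh root coroot
         (Bracket (Gen (H h)) (Gen (E i))) (Scale (root i h) (Gen (E i)))"
| HF: "km_relation A scaleh root coroot
         (Bracket (Gen (H h)) (Gen (F i))) (Scale (- root i h) (Gen (F i)))"
| serre_E: "i \<noteq> j \<Longrightarrow> km_relation A scaleh root coroot
              ((Bracket (Gen (E i)) ^^ nat (1 - A $ i $ j)) (Gen (E j))) Zero"
| serre_F: "i \<noteq> j \<Longrightarrow> km_relation A scaleh root coroot
              ((Bracket (Gen (F i)) ^^ nat (1 - A $ i $ j)) (Gen (F j))) Zero"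

text \<open>\<open>\<iota>\<close> is the canonical map from \<open>'h\<close> to the algebra; its injectivity is not an assumption.\<close>

locale kac_moody_algebra =
  H: realization A scaleh root coroot + lie_algebra scale bracket
  for A :: "int^'i::finite^'i"
    and scaleh :: "complex \<Rightarrow> 'h::ab_group_add \<Rightarrow> 'h"
    and root :: "'i \<Rightarrow> 'h \<Rightarrow> complex"
    and coroot :: "'i \<Rightarrow> 'h"
    and scale :: "complex \<Rightarrow> 'g::ab_group_add \<Rightarrow> 'g" (infixr \<open>\<odot>\<close> 75)
    and bracket :: "'g \<Rightarrow> 'g \<Rightarrow> 'g" +
  fixes \<iota> :: "'h \<Rightarrow> 'g"
    and e f :: "'i \<Rightarrow> 'g"
  assumes cartan_matrix: "generalized_cartan_matrix A"
    and presented: "presented_by (case_km_generator \<iota> e f) (km_relation A scaleh root coroot)"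
begin

definition weight_space :: "('h \<Rightarrow> complex) \<Rightarrow> 'g set" where
  "weight_space \<alpha> = {x. \<forall>h. bracket (\<iota> h) x = \<alpha> h \<odot> x}"

definition Q_plus :: "('h \<Rightarrow> complex) set" where
  "Q_plus = {\<alpha>. \<exists>k :: 'i \<Rightarrow> nat. \<alpha> = (\<lambda>h. \<Sum>i\<in>UNIV. of_nat (k i) * root i h)}"

text \<open>A sum of weight spaces is automatically direct, so it is given as a linear span.\<close>

definition borel_plus :: "'g set" where
  "borel_plus = span (\<Union>\<alpha>\<in>Q_plus. weight_space \<alpha>)"

definition borel_minus :: "'g set" where
  "borel_minus = span (\<Union>\<alpha>\<in>Q_plus. weight_space (\<lambda>h. - \<alpha> h))"

end

end

theory Submission
  imports Defs
begin

text \<open>Choose \<open>h0\<close> on which the simple roots take distinct positive integer values \<open>d i\<close>, none of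
  them a sum of others, and grade everything by the eigenvalues of \<open>t = \<iota> h0\<close>. For an
  \<open>N\<close>-derivation \<open>\<phi>\<close> let \<open>\<delta>(x,y) = \<phi>[x,y] - [\<phi> x,y] - [x,\<phi> y]\<close>; being an \<open>N\<close>-derivation means
  \<open>\<Sum>\<^sub>i [x\<^sub>1,\<dots>,x\<^sub>i\<^sub>-\<^sub>1,\<delta>(x\<^sub>i,[x\<^sub>i\<^sub>+\<^sub>1,\<dots>,x\<^sub>N])] = 0\<close>. Setting \<open>x\<^sub>1 = \<dots> = x\<^sub>N\<^sub>-\<^sub>1 = t\<close> gives \<open>\<delta>(t,z)\<close> of
  degree \<open>-k\<close> for \<open>z\<close> of degree \<open>k \<noteq> 0\<close>, and \<open>x\<^sub>2 = \<dots> = x\<^sub>N\<^sub>-\<^sub>1 = t\<close> gives that \<open>\<delta>(x,z)\<close> is \<open>0\<close>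
  for even \<open>N\<close> and \<open>- [x,\<delta>(t,z)] / k\<close> for odd \<open>N\<close>. If \<open>ad s\<close> is injective in degree \<open>-deg s\<close>
  (true for \<open>e\<^sub>i\<close> and \<open>f\<^sub>i\<close>, whose opposite degree space is a line, and for every element of
  positive degree of a Borel subalgebra), then \<open>\<delta>(s,s) = 0\<close> forces \<open>\<delta>(t,s) = 0\<close>, hence
  \<open>\<delta>(\<cdot>,s) = 0\<close>. Taking \<open>x\<^sub>N\<^sub>-\<^sub>1 = s\<close> spreads this to all brackets \<open>[s,y]\<close> of nonzero degree. In
  degree \<open>0\<close>, \<open>\<delta>(h,h') = [h',\<phi> h] - [h,\<phi> h']\<close> is of degree \<open>0\<close> but has no degree \<open>0\<close> component.\<close>

section \<open>Bracket calculus in a Lie algebra\<close>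

context lie_algebra
begin

lemma bracket_add_right: "bracket x (y + z) = bracket x y + bracket x z"
  and bracket_scale_right: "bracket x (c \<odot> y) = c \<odot> bracket x y"
  using linear_bracket_right by (simp_all add: Vector_Spaces.linear_iff)

lemma bracket_add_left: "bracket (x + y) z = bracket x z + bracket y z"
  and bracket_scale_left: "bracket (c \<odot> x) z = c \<odot> bracket x z"
  using linear_bracket_left by (simp_all add: Vector_Spaces.linear_iff)

lemma bracket_zero_right [simp]: "bracket x 0 = 0"
  using bracket_scale_right[of x 0 0] by simp

lemma bracket_zero_left [simp]: "bracket 0 x = 0"
  using bracket_scale_left[of 0 0 x] by simp

lemma bracket_minus_right: "bracket x (- y) = - bracket x y"
  using bracket_scale_right[of x "-1" y] by simp

lemma bracket_minus_left: "bracket (- x) y = - bracket x y"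
  using bracket_scale_left[of "-1" x y] by simp

lemma bracket_sum_right: "bracket x (sum u K) = (\<Sum>k\<in>K. bracket x (u k))"
  by (induction K rule: infinite_finite_induct) (simp_all add: bracket_add_right)

lemma bracket_commute: "bracket x y = - bracket y x"
proof -
  have "bracket (x + y) (x + y) = bracket x y + bracket y x"
    by (simp add: bracket_add_left bracket_add_right bracket_self[of x] bracket_self[of y])
  then have "bracket x y + bracket y x = 0" by (metis bracket_self)
  then show ?thesis by (simp add: eq_neg_iff_add_eq_0)
qed

lemma bracket_bracket: "bracket x (bracket y z) = bracket (bracket x y) z + bracket y (bracket x z)"
proof -
  have "bracket y (bracket z x) = - bracket y (bracket x z)"
    by (subst bracket_commute[of z x]) (rule bracket_minus_right)
  moreover have "bracket z (bracket x y) = - bracket (bracket x y) z"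
    by (rule bracket_commute)
  ultimately show ?thesis
    using bracket_jacobi[of x y z] by (simp add: algebra_simps)
qed

lemma bracket_in_subspace_span:
  assumes "x \<in> span B" and "subspace V" and "\<And>b. b \<in> B \<Longrightarrow> bracket y b \<in> V"
  shows "bracket y x \<in> V"
proof -
  have "subspace {x. bracket y x \<in> V}"
    using assms(2) unfolding subspace_def by (auto simp: bracket_add_right bracket_scale_right)
  then show ?thesis
    using span_subspace_induct[of x B "{x. bracket y x \<in> V}"] assms(1,3) by auto
qed

subsection \<open>Integral eigenspaces of an inner derivation\<close>

text \<open>Integral degrees suffice because \<open>h0\<close> will be chosen with integral root
  values. Integrality matters in \<open>sum_powers_nonzero\<close>, where an integer is determined
  up to sign by any positive power of it.\<close>

definition eigenspace :: "'g \<Rightarrow> int \<Rightarrow> 'g set" where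
  "eigenspace t k = {x. bracket t x = of_int k \<odot> x}"

lemma eigenspaceD: "x \<in> eigenspace t k \<Longrightarrow> bracket t x = of_int k \<odot> x"
  by (simp add: eigenspace_def)

lemma subspace_eigenspace: "subspace (eigenspace t k)"
  unfolding subspace_def eigenspace_def
  by (auto simp: bracket_add_right bracket_scale_right scale_right_distrib mult.commute)

lemma eigenspace_bracket:
  assumes "x \<in> eigenspace t j" and "y \<in> eigenspace t k"
  shows "bracket x y \<in> eigenspace t (j + k)"
  using assms unfolding eigenspace_def
  by (simp add: bracket_bracket[of t] bracket_scale_left bracket_scale_right scale_left_distrib)

lemma eigenspace_minus: "eigenspace (- t) k = eigenspace t (- k)"
  unfolding eigenspace_def by (auto simp: bracket_minus_left minus_equation_iff[of "bracket t _"])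

lemma funpow_eigenspace:
  "x \<in> eigenspace t k \<Longrightarrow> (bracket t ^^ n) x = of_int k ^ n \<odot> x"
  by (induction n) (simp_all add: eigenspaceD bracket_scale_right mult.commute)

lemma funpow_bracket_sum: "(bracket t ^^ n) (sum u K) = (\<Sum>k\<in>K. (bracket t ^^ n) (u k))"
  by (induction n) (simp_all add: bracket_sum_right)

lemma eigenspace_independent:
  assumes "finite K" and "\<And>m. m \<in> K \<Longrightarrow> u m \<in> eigenspace t m" and "sum u K = 0" and "m \<in> K"
  shows "u m = 0"
  using assms
proof (induction K arbitrary: u m rule: finite_induct)
  case (insert a K)
  have sum0: "u a + sum u K = 0" using insert by simp
  \<comment> \<open>Applying \<open>ad t - a\<close> kills the component of degree \<open>a\<close>
    and multiplies the others by the nonzero factors \<open>m - a\<close>.\<close>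
  have "0 = bracket t (u a + sum u K) - of_int a \<odot> (u a + sum u K)"
    unfolding sum0 by simp
  also have "\<dots> = (\<Sum>m\<in>K. bracket t (u m) - of_int a \<odot> u m)"
    using insert.prems(1)
    by (simp add: bracket_add_right bracket_sum_right scale_right_distrib scale_sum_right
        sum_subtractf eigenspaceD)
  also have "\<dots> = (\<Sum>m\<in>K. of_int (m - a) \<odot> u m)"
    using insert.prems(1) by (intro sum.cong refl) (auto simp: eigenspaceD scale_left_diff_distrib)
  finally have "(\<Sum>m\<in>K. of_int (m - a) \<odot> u m) = 0" by simp
  then have "of_int (k - a) \<odot> u k = 0" if "k \<in> K" for k
    using insert.IH[of "\<lambda>m. of_int (m - a) \<odot> u m" k] insert.prems(1) that
    by (auto intro: subspace_scale[OF subspace_eigenspace])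
  then have K: "u k = 0" if "k \<in> K" for k
    using that insert.hyps(2) by (auto simp del: of_int_diff)
  then have "sum u K = 0" by simp
  then show ?case using sum0 K insert.prems(3) by auto
qed simp

lemma span_eigenspaces_decomposition:
  assumes "x \<in> span (\<Union>m\<in>I. eigenspace t m)"
  obtains K u where "finite K" "K \<subseteq> I" "\<And>m. u m \<in> eigenspace t m" "x = sum u K"
proof -
  have "\<exists>K u. finite K \<and> K \<subseteq> I \<and> (\<forall>m. u m \<in> eigenspace t m) \<and> x = sum u K"
    using assms
  proof (induction x rule: span_induct_alt)
    case base
    show ?case
      by (rule exI[of _ "{}"], rule exI[of _ "\<lambda>_. 0"])
        (simp add: subspace_0[OF subspace_eigenspace])
  next
    case (step c z y)
    then obtain K u a where K: "finite K" "K \<subseteq> I" "\<And>m. u m \<in> eigenspace t m" "y = sum u K"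
      and a: "a \<in> I" "z \<in> eigenspace t a" by auto
    \<comment> \<open>Outside \<open>K\<close> the family \<open>u\<close> may be nonzero, in
      particular at \<open>a\<close>, so it is cut off before the new index is added.\<close>
    define v where "v m = (if m \<in> K then u m else 0)" for m
    have v: "sum v (insert a K) = y" "v m \<in> eigenspace t m" for m
      using K unfolding v_def
      by (auto simp: sum.insert_if subspace_0[OF subspace_eigenspace])
    have "c \<odot> z + y = sum (\<lambda>m. v m + (if m = a then c \<odot> z else 0)) (insert a K)"
      using K(1) v(1) by (simp add: sum.distrib add.commute)
    moreover have "v m + (if m = a then c \<odot> z else 0) \<in> eigenspace t m" for m
      using v(2) a(2) subspace_eigenspace[of t m]
      by (auto intro: subspace_add subspace_scale)
    ultimately show ?case
      using K(1,2) a(1) by (intro exI[of _ "insert a K"] exI conjI) auto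
  qed
  then show ?thesis using that by blast
qed

lemma eigenspace_inter_span:
  assumes "x \<in> eigenspace t a" and "x \<in> span (\<Union>m\<in>I. eigenspace t m)" and "a \<notin> I"
  shows "x = 0"
proof -
  obtain K u where K: "finite K" "K \<subseteq> I" "\<And>m. u m \<in> eigenspace t m" "x = sum u K"
    using span_eigenspaces_decomposition[OF assms(2)] by metis
  define v where "v m = (if m = a then - x else u m)" for m
  have aK: "a \<notin> K" using K(2) assms(3) by auto
  have "sum v K = sum u K" using aK by (intro sum.cong) (auto simp: v_def)
  then have "sum v (insert a K) = 0" using aK K(1,4) by (simp add: v_def)
  moreover have "v m \<in> eigenspace t m" for m
    using K(3) assms(1) subspace_neg[OF subspace_eigenspace] by (simp add: v_def)
  ultimately have "v a = 0"
    using eigenspace_independent[of "insert a K" v t a] K(1) by auto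
  then show ?thesis by (simp add: v_def)
qed

text \<open>In a decomposition \<open>x = y + z\<close> along the two spanning sets,
  \<open>z = x - y\<close> has degree \<open>a\<close> and also lies in the sum of the other
  eigenspaces, so it vanishes.\<close>

lemma eigenspace_subset_span:
  assumes "x \<in> eigenspace t a" and "x \<in> span (B \<union> (\<Union>m\<in>-{a}. eigenspace t m))"
    and "B \<subseteq> eigenspace t a"
  shows "x \<in> span B"
proof -
  obtain y z where yz: "y \<in> span B" "z \<in> span (\<Union>m\<in>-{a}. eigenspace t m)" "x = y + z"
    using assms(2) unfolding span_Un by auto
  have "y \<in> eigenspace t a"
    using yz(1) span_minimal[OF assms(3) subspace_eigenspace] by auto
  then have "z \<in> eigenspace t a"
    using subspace_diff[OF subspace_eigenspace assms(1), of y] yz(3) by simp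
  then have "z = 0" using eigenspace_inter_span[OF _ yz(2)] by simp
  then show ?thesis using yz by simp
qed

text \<open>The polynomial with coefficients \<open>c\<close>, evaluated at \<open>ad t\<close>,
  acts on the degree \<open>m\<close> component of \<open>x\<close> as its value at
  \<open>m\<close>. It has no integer root except possibly \<open>a\<close>, so all components of
  other degrees vanish.\<close>

lemma polynomial_kernel_in_eigenspace:
  assumes "x \<in> span (\<Union>m. eigenspace t m)"
    and "(\<Sum>i<n. c i \<odot> (bracket t ^^ i) x) = 0"
    and "\<And>m. m \<noteq> a \<Longrightarrow> (\<Sum>i<n. c i * of_int m ^ i) \<noteq> 0"
  shows "x \<in> eigenspace t a"
proof -
  obtain K u where K: "finite K" "\<And>m. u m \<in> eigenspace t m" "x = sum u K"
    using span_eigenspaces_decomposition[OF assms(1)] by metis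
  let ?q = "\<lambda>m. \<Sum>i<n. c i * of_int m ^ i"
  have "0 = (\<Sum>i<n. \<Sum>m\<in>K. (c i * of_int m ^ i) \<odot> u m)"
    unfolding assms(2)[symmetric] K(3)
    by (simp add: funpow_bracket_sum funpow_eigenspace[OF K(2)] scale_sum_right)
  also have "\<dots> = (\<Sum>m\<in>K. ?q m \<odot> u m)"
    by (subst sum.swap) (simp add: scale_sum_left)
  finally have "?q m \<odot> u m = 0" if "m \<in> K" for m
    using eigenspace_independent[of K "\<lambda>m. ?q m \<odot> u m" t m] K(1,2) that
    by (auto intro: subspace_scale[OF subspace_eigenspace])
  then have "u m \<in> eigenspace t a" if "m \<in> K" for m
    using assms(3)[of m] that K(2)[of m] subspace_0[OF subspace_eigenspace[of t a]]
    by (metis scale_eq_0_iff)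
  then show ?thesis unfolding K(3) by (intro subspace_sum subspace_eigenspace)
qed

subsection \<open>The defect of a linear map from being a derivation\<close>

definition defect :: "('g \<Rightarrow> 'g) \<Rightarrow> 'g \<Rightarrow> 'g \<Rightarrow> 'g" where
  "defect \<phi> x y = \<phi> (bracket x y) - bracket (\<phi> x) y - bracket x (\<phi> y)"

text \<open>This is the amount by which \<open>\<phi>\<close> fails the Leibniz rule on the
  right-normed bracket of the entries of \<open>xs\<close> followed by \<open>y\<close>. The
  innermost entry is kept apart, so an \<open>N\<close>-fold bracket has \<open>N - 1\<close>
  entries in \<open>xs\<close>.\<close>

fun iterated_defect :: "('g \<Rightarrow> 'g) \<Rightarrow> 'g list \<Rightarrow> 'g \<Rightarrow> 'g" where
  "iterated_defect \<phi> [] y = 0"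
| "iterated_defect \<phi> (x # xs) y
     = defect \<phi> x (foldr bracket xs y) + bracket x (iterated_defect \<phi> xs y)"

lemma nested_bracket_append: "nested_bracket (xs @ [y]) = foldr bracket xs y"
proof (induction xs)
  case (Cons x xs)
  then show ?case by (cases "xs @ [y]") auto
qed simp

text \<open>This merges the two innermost entries into one bracket, at the price of a single defect.
  Where that defect is known to vanish, information passes to \<open>bracket x y\<close>.\<close>

lemma iterated_defect_append:
  "iterated_defect \<phi> (xs @ [x]) y
     = iterated_defect \<phi> xs (bracket x y) + foldr bracket xs (defect \<phi> x y)"
  by (induction xs) (simp_all add: bracket_add_right add_ac)

lemma foldr_bracket_closed:
  assumes "\<And>x y. x \<in> L \<Longrightarrow> y \<in> L \<Longrightarrow> bracket x y \<in> L" and "set xs \<subseteq> L" and "y \<in> L"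
  shows "foldr bracket xs y \<in> L"
  using assms(2,3) by (induction xs) (auto intro: assms(1))

lemma foldr_replicate_bracket: "foldr bracket (replicate n t) y = (bracket t ^^ n) y"
  by (induction n) simp_all

lemma funpow_bracket_zero [simp]: "(bracket t ^^ n) 0 = 0"
  by (induction n) simp_all

text \<open>Each bracket from which \<open>\<phi>\<close> is pulled out costs one
  \<open>defect\<close>, and these add up to the correction term
  \<open>iterated_defect\<close>.\<close>

lemma apply_foldr_bracket:
  "\<phi> (foldr bracket xs y) = iterated_defect \<phi> xs y + foldr bracket xs (\<phi> y)
     + (\<Sum>i<length xs. foldr bracket (xs[i := \<phi> (xs ! i)]) y)"
proof (induction xs)
  case (Cons x xs)
  have "\<phi> (bracket x (foldr bracket xs y)) = defect \<phi> x (foldr bracket xs y)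
      + bracket (\<phi> x) (foldr bracket xs y) + bracket x (\<phi> (foldr bracket xs y))"
    by (simp add: defect_def)
  then show ?case
    unfolding Cons by (simp add: sum.lessThan_Suc_shift bracket_add_right bracket_sum_right add_ac
        del: sum.lessThan_Suc)
qed simp

lemma N_derivation_iff:
  "\<phi> (nested_bracket (xs @ [y])) = (\<Sum>i<Suc (length xs). nested_bracket ((xs @ [y])[i := \<phi> ((xs @ [y]) ! i)]))
     \<longleftrightarrow> iterated_defect \<phi> xs y = 0"
proof -
  have "(\<Sum>i<Suc (length xs). nested_bracket ((xs @ [y])[i := \<phi> ((xs @ [y]) ! i)]))
    = (\<Sum>i<length xs. foldr bracket (xs[i := \<phi> (xs ! i)]) y) + foldr bracket xs (\<phi> y)"
    by (simp add: list_update_append nth_append nested_bracket_append)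
  then show ?thesis
    using apply_foldr_bracket[of \<phi> xs y] by (simp add: nested_bracket_append algebra_simps)
qed

lemma N_derivations_iff_iterated_defect:
  "\<phi> \<in> N_derivations (Suc n) L \<longleftrightarrow> \<phi> \<in> linear_endos L \<and>
     (\<forall>xs y. length xs = n \<and> set xs \<subseteq> L \<and> y \<in> L \<longrightarrow> iterated_defect \<phi> xs y = 0)"
  (is "_ \<longleftrightarrow> _ \<and> ?R")
proof -
  have "(\<forall>xs. length xs = Suc n \<and> set xs \<subseteq> L \<longrightarrow>
       \<phi> (nested_bracket xs) = (\<Sum>i<Suc n. nested_bracket (xs[i := \<phi> (xs ! i)]))) \<longleftrightarrow> ?R"
    (is "?Q \<longleftrightarrow> _")
  proof
    assume Q: ?Q
    show ?R
    proof (intro allI impI)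
      fix xs y assume *: "length xs = n \<and> set xs \<subseteq> L \<and> y \<in> L"
      show "iterated_defect \<phi> xs y = 0"
        using Q[rule_format, of "xs @ [y]"] * N_derivation_iff[of \<phi> xs y] by auto
    qed
  next
    assume R: ?R
    show ?Q
    proof (intro allI impI)
      fix zs assume *: "length zs = Suc n \<and> set zs \<subseteq> L"
      then obtain xs y where "zs = xs @ [y]" by (metis length_0_conv nat.distinct(1) rev_exhaust)
      with * show "\<phi> (nested_bracket zs) = (\<Sum>i<Suc n. nested_bracket (zs[i := \<phi> (zs ! i)]))"
        using R N_derivation_iff[of \<phi> xs y] by auto
    qed
  qed
  then show ?thesis unfolding N_derivations_def by auto
qed

lemma derivations_iff_defect:
  "\<phi> \<in> derivations L \<longleftrightarrow> \<phi> \<in> linear_endos L \<and> (\<forall>x\<in>L. \<forall>y\<in>L. defect \<phi> x y = 0)"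
  unfolding derivations_def defect_def by (auto simp: algebra_simps)

lemma derivations_subset_N_derivations:
  assumes "\<And>x y. x \<in> L \<Longrightarrow> y \<in> L \<Longrightarrow> bracket x y \<in> L"
  shows "derivations L \<subseteq> N_derivations (Suc n) L"
proof
  fix \<phi> assume \<phi>: "\<phi> \<in> derivations L"
  have "iterated_defect \<phi> xs y = 0" if "set xs \<subseteq> L" "y \<in> L" for xs y
    using that \<phi>
    by (induction xs) (auto simp: derivations_iff_defect foldr_bracket_closed[OF assms])
  then show "\<phi> \<in> N_derivations (Suc n) L"
    using \<phi> by (auto simp: N_derivations_iff_iterated_defect derivations_iff_defect)
qed

text \<open>In the term of index \<open>i\<close>, \<open>i\<close> copies of \<open>t\<close> stand
  outside the defect, and the remaining \<open>n - Suc i\<close> act on \<open>y\<close> as powers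
  of \<open>k\<close>. The sum is the polynomial \<open>(X^n - k^n) / (X - k)\<close> at
  \<open>X = ad t\<close>, applied to \<open>defect \<phi> t y\<close>.\<close>

lemma iterated_defect_replicate:
  assumes "y \<in> eigenspace t k" and scale: "\<And>c. defect \<phi> t (c \<odot> y) = c \<odot> defect \<phi> t y"
  shows "iterated_defect \<phi> (replicate n t) y
     = (\<Sum>i<n. of_int k ^ (n - Suc i) \<odot> (bracket t ^^ i) (defect \<phi> t y))"
  by (induction n)
    (simp_all add: sum.lessThan_Suc_shift foldr_replicate_bracket funpow_eigenspace[OF assms(1)]
        scale bracket_sum_right bracket_scale_right del: sum.lessThan_Suc)

text \<open>On \<open>defect \<phi> t y\<close> the map \<open>ad t\<close> is now multiplication by
  \<open>- k\<close>, so the terms alternate in sign and cancel in pairs.\<close>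

lemma iterated_defect_replicate_eigenspace:
  assumes "y \<in> eigenspace t k" and "defect \<phi> t y \<in> eigenspace t (- k)"
    and "\<And>c. defect \<phi> t (c \<odot> y) = c \<odot> defect \<phi> t y"
  shows "iterated_defect \<phi> (replicate n t) y
     = (if even n then 0 else of_int k ^ (n - 1)) \<odot> defect \<phi> t y"
proof (induction n)
  case (Suc n)
  have "iterated_defect \<phi> (replicate (Suc n) t) y
      = of_int k ^ n \<odot> defect \<phi> t y - of_int k \<odot> (if even n then 0 else of_int k ^ (n - 1)) \<odot> defect \<phi> t y"
    using Suc assms
    by (simp add: foldr_replicate_bracket funpow_eigenspace bracket_scale_right eigenspaceD mult.commute)
  moreover have "of_int k * of_int k ^ (n - 1) = (of_int k ^ n :: complex)" if "odd n"
    using that by (cases n) auto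
  ultimately show ?case by auto
qed simp

end

text \<open>The sum is \<open>(n + 1) k^n\<close> for \<open>m = k\<close> and the quotient of
  \<open>m^(n+1) - k^(n+1)\<close> by \<open>m - k\<close> otherwise. Integers with equal positive
  powers agree up to sign, so \<open>- k\<close> is the only possible integer root.\<close>

lemma sum_powers_nonzero:
  fixes k m :: int
  assumes "k \<noteq> 0" and "m \<noteq> - k"
  shows "(\<Sum>i<Suc n. of_int k ^ (n - i) * of_int m ^ i :: complex) \<noteq> 0"
proof (cases "m = k")
  case True
  have "(\<Sum>i<Suc n. of_int k ^ (n - i) * of_int m ^ i) = (\<Sum>i<Suc n. of_int k ^ n :: complex)"
    unfolding True by (intro sum.cong refl) (auto simp flip: power_add)
  also have "\<dots> = of_nat (Suc n) * of_int k ^ n" by (simp del: of_nat_Suc)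
  finally show ?thesis using assms by (simp del: of_nat_Suc)
next
  case False
  have ne: "m ^ Suc n \<noteq> k ^ Suc n"
  proof
    assume "m ^ Suc n = k ^ Suc n"
    then have "\<bar>m\<bar> ^ Suc n = \<bar>k\<bar> ^ Suc n" by (metis power_abs)
    then have "\<bar>m\<bar> = \<bar>k\<bar>" using power_eq_imp_eq_base[of "\<bar>m\<bar>" "Suc n" "\<bar>k\<bar>"] by simp
    then show False using False assms by (auto simp: abs_eq_iff)
  qed
  have "(of_int m - of_int k) * (\<Sum>i<Suc n. of_int k ^ (n - i) * of_int m ^ i)
      = (of_int m ^ Suc n - of_int k ^ Suc n :: complex)"
    using power_diff_sumr2[of "of_int m :: complex" "Suc n" "of_int k"] by simp
  also have "\<dots> = of_int (m ^ Suc n - k ^ Suc n)" by simp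
  also have "\<dots> \<noteq> 0" using ne by (simp del: power_Suc of_int_power of_int_diff)
  finally show ?thesis by auto
qed

section \<open>N-derivations of graded subalgebras\<close>

lemma (in lie_algebra) linear_endosD:
  assumes "\<phi> \<in> linear_endos L"
  shows "x \<in> L \<Longrightarrow> \<phi> x \<in> L"
    and "x \<in> L \<Longrightarrow> y \<in> L \<Longrightarrow> \<phi> (x + y) = \<phi> x + \<phi> y"
    and "x \<in> L \<Longrightarrow> \<phi> (c \<odot> x) = c \<odot> \<phi> x"
  using assms unfolding linear_endos_def by auto

text \<open>For such \<open>s\<close> a factor \<open>s\<close> can be cancelled from
  \<open>bracket s w = 0\<close>; this will be applied to
  \<open>w = defect \<phi> t s\<close>.\<close>

definition (in lie_algebra) faithful_vectors :: "'g set \<Rightarrow> 'g \<Rightarrow> 'g set" where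
  "faithful_vectors L t = {s. \<exists>k. k \<noteq> 0 \<and> s \<in> L \<inter> eigenspace t k \<and>
     (\<forall>w\<in>L \<inter> eigenspace t (- k). bracket s w = 0 \<longrightarrow> w = 0)}"

text \<open>The common setting for the whole algebra and its Borel subalgebras. The third spanning
  set serves the whole algebra, where only the Chevalley generators are shown to be faithful and
  longer words enter as brackets with them.\<close>

locale graded_subalgebra = lie_algebra scale bracket
  for scale :: "complex \<Rightarrow> 'g::ab_group_add \<Rightarrow> 'g" (infixr \<open>\<odot>\<close> 75)
    and bracket :: "'g \<Rightarrow> 'g \<Rightarrow> 'g" +
  fixes L :: "'g set" and t :: 'g
  assumes subspace_L: "subspace L"
    and bracket_closed: "x \<in> L \<Longrightarrow> y \<in> L \<Longrightarrow> bracket x y \<in> L"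
    and t_in: "t \<in> L"
    and zero_part_abelian:
      "x \<in> L \<Longrightarrow> x \<in> eigenspace t 0 \<Longrightarrow> y \<in> L \<Longrightarrow> y \<in> eigenspace t 0 \<Longrightarrow> bracket x y = 0"
    and generated: "L \<subseteq> span ((L \<inter> eigenspace t 0) \<union> faithful_vectors L t \<union>
      {bracket s y | s y k. s \<in> faithful_vectors L t \<and> y \<in> L \<and> k \<noteq> 0 \<and> bracket s y \<in> eigenspace t k})"
begin

lemma subset_span_eigenspaces: "L \<subseteq> span (\<Union>m. eigenspace t m)"
  by (rule subset_trans[OF generated], rule span_mono) (auto simp: faithful_vectors_def)

lemma faithful_in_L: "faithful_vectors L t \<subseteq> L"
  by (auto simp: faithful_vectors_def)

lemma span_induct_generated:
  assumes "x \<in> L" and "subspace V" and "L \<inter> eigenspace t 0 \<subseteq> V" and "faithful_vectors L t \<subseteq> V"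
    and "\<And>s y k. s \<in> faithful_vectors L t \<Longrightarrow> y \<in> L \<Longrightarrow> k \<noteq> 0 \<Longrightarrow> bracket s y \<in> eigenspace t k
      \<Longrightarrow> bracket s y \<in> V"
  shows "x \<in> V"
proof -
  have "span ((L \<inter> eigenspace t 0) \<union> faithful_vectors L t \<union>
      {bracket s y | s y k. s \<in> faithful_vectors L t \<and> y \<in> L \<and> k \<noteq> 0 \<and> bracket s y \<in> eigenspace t k})
      \<subseteq> V"
    using assms(3-5) by (intro span_minimal assms(2)) auto
  then show ?thesis using generated assms(1) by blast
qed

lemma N_derivation_is_derivation:
  assumes "N \<ge> 3" and "\<phi> \<in> N_derivations N L"
  shows "\<phi> \<in> derivations L"
proof -
  \<comment> \<open>With \<open>N = n + 3\<close> there are \<open>n + 2\<close> entries before the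
    innermost one, and \<open>even (Suc n)\<close> says that \<open>N\<close> is even.\<close>
  obtain n where N: "N = Suc (Suc (Suc n))"
    using assms(1) by (metis Suc_le_D numeral_3_eq_3 Suc_le_mono)
  have endo: "\<phi> \<in> linear_endos L"
    and star: "\<And>xs y. length xs = Suc (Suc n) \<Longrightarrow> set xs \<subseteq> L \<Longrightarrow> y \<in> L \<Longrightarrow> iterated_defect \<phi> xs y = 0"
    using assms(2) unfolding N N_derivations_iff_iterated_defect by auto
  note \<phi> = linear_endosD[OF endo]
  let ?\<delta> = "defect \<phi>"
  have in_L: "?\<delta> x y \<in> L" if "x \<in> L" "y \<in> L" for x y
    unfolding defect_def using that by (intro subspace_diff subspace_L bracket_closed \<phi>)
  have \<delta>_add: "?\<delta> x (y + z) = ?\<delta> x y + ?\<delta> x z" if "x \<in> L" "y \<in> L" "z \<in> L" for x y z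
    using that \<phi>(2) by (simp add: defect_def bracket_add_right bracket_closed)
  have \<delta>_scale: "?\<delta> x (c \<odot> y) = c \<odot> ?\<delta> x y" if "x \<in> L" "y \<in> L" for x y c
    using that \<phi>(3) by (simp add: defect_def bracket_scale_right bracket_closed scale_right_diff_distrib)
  have \<phi>0: "\<phi> 0 = 0"
    using \<phi>(3)[of 0 0] subspace_0[OF subspace_L] by simp
  have \<delta>_commute: "?\<delta> x y = - ?\<delta> y x" if "x \<in> L" "y \<in> L" for x y
  proof -
    have "\<phi> (bracket x y) = - \<phi> (bracket y x)"
      using \<phi>(3)[of "bracket y x" "-1"] that bracket_commute[of x y] by (simp add: bracket_closed)
    then show ?thesis
      by (simp add: defect_def bracket_commute[of "\<phi> x" y] bracket_commute[of x "\<phi> y"])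
  qed
  have \<delta>_self: "?\<delta> x x = 0" for x
    by (simp add: defect_def bracket_self \<phi>0 bracket_commute[of "\<phi> x" x])
  have sub: "subspace {z \<in> L. ?\<delta> x z = 0}" if "x \<in> L" for x
    unfolding subspace_def
    using that subspace_L \<delta>_add[OF that] \<delta>_scale[OF that] \<delta>_scale[OF that, of 0 0]
    by (auto simp: subspace_def)
  have rep_in: "set (replicate m t) \<subseteq> L" for m using t_in by (auto dest: in_set_replicate[THEN iffD1])
  have funpow_in: "(bracket t ^^ m) y \<in> L" if "y \<in> L" for m y
    using that by (induction m) (auto intro: bracket_closed t_in)

  \<comment> \<open>All outer entries are \<open>t\<close>. As \<open>\<phi>\<close> need not
    respect degrees, the degree of \<open>?\<delta> t z\<close> is read off from a polynomial in
    \<open>ad t\<close> that annihilates it and has no integer root besides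
    \<open>- k\<close>.\<close>
  have opposite: "?\<delta> t z \<in> eigenspace t (- k)" if z: "z \<in> L" "z \<in> eigenspace t k" and "k \<noteq> 0" for z k
  proof (rule polynomial_kernel_in_eigenspace)
    show "?\<delta> t z \<in> span (\<Union>m. eigenspace t m)"
      using in_L t_in z subset_span_eigenspaces by auto
    have "iterated_defect \<phi> (replicate (Suc (Suc n)) t) z = 0"
      by (rule star) (use rep_in[of "Suc (Suc n)"] z in auto)
    then show "(\<Sum>i<Suc (Suc n). of_int k ^ (Suc n - i) \<odot> (bracket t ^^ i) (?\<delta> t z)) = 0"
      by (subst (asm) iterated_defect_replicate[OF z(2) \<delta>_scale[OF t_in z(1)]]) simp
    show "(\<Sum>i<Suc (Suc n). of_int k ^ (Suc n - i) * of_int m ^ i) \<noteq> (0 :: complex)"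
      if "m \<noteq> - k" for m
      by (rule sum_powers_nonzero) (use that \<open>k \<noteq> 0\<close> in auto)
  qed

  note replicate = iterated_defect_replicate_eigenspace[OF _ opposite \<delta>_scale[OF t_in]]

  \<comment> \<open>The outer entries are \<open>x\<close> and \<open>n + 1\<close> copies of
    \<open>t\<close>; the parity of \<open>n + 1\<close> decides whether the copies of
    \<open>t\<close> contribute.\<close>
  have right_t: "of_int k ^ Suc n \<odot> ?\<delta> x z
      + bracket x ((if even (Suc n) then 0 else of_int k ^ n) \<odot> ?\<delta> t z) = 0"
    if "x \<in> L" and z: "z \<in> L" "z \<in> eigenspace t k" "k \<noteq> 0" for x z k
  proof -
    have "iterated_defect \<phi> (x # replicate (Suc n) t) z = 0"
      by (rule star) (use rep_in[of "Suc n"] that in auto)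
    then have "?\<delta> x (of_int k ^ Suc n \<odot> z) + bracket x (iterated_defect \<phi> (replicate (Suc n) t) z) = 0"
      by (simp only: iterated_defect.simps foldr_replicate_bracket funpow_eigenspace[OF z(2)])
    then show ?thesis
      using replicate[of z k "Suc n"] z \<delta>_scale[OF that(1,2)]
      by (cases "even n") (simp_all del: iterated_defect.simps replicate_Suc power_Suc)
  qed

  have even_case: "?\<delta> x z = 0" if "even (Suc n)" "x \<in> L" "z \<in> L" "z \<in> eigenspace t k" "k \<noteq> 0" for x z k
    using right_t[OF that(2-5)] that(1,5) by simp

  have faithful: "?\<delta> x s = 0" if s: "s \<in> faithful_vectors L t" and "x \<in> L" for x s
  proof -
    obtain k where k: "k \<noteq> 0" "s \<in> L" "s \<in> eigenspace t k"
      and inj: "\<And>w. w \<in> L \<Longrightarrow> w \<in> eigenspace t (- k) \<Longrightarrow> bracket s w = 0 \<Longrightarrow> w = 0"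
      using s unfolding faithful_vectors_def by auto
    show ?thesis
    proof (cases "even (Suc n)")
      case True
      then show ?thesis using even_case that k by blast
    next
      case False
      \<comment> \<open>In \<open>right_t\<close> with both arguments \<open>s\<close> the first
        term vanishes because \<open>?\<delta> s s = 0\<close>.\<close>
      then have "of_int k ^ n \<odot> bracket s (?\<delta> t s) = 0"
        using right_t[OF k(2,2,3,1)] by (simp add: \<delta>_self bracket_scale_right)
      then have "bracket s (?\<delta> t s) = 0" using k(1) by simp
      then have "?\<delta> t s = 0" using inj opposite in_L t_in k by blast
      then show ?thesis using right_t[OF that(2) k(2,3,1)] k(1) by simp
    qed
  qed

  have generator_bracket: "?\<delta> x (bracket s y) = 0"
    if "x \<in> L" and s: "s \<in> faithful_vectors L t" and y: "y \<in> L"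
      and k: "k \<noteq> 0" "bracket s y \<in> eigenspace t k" for x s y k
  proof (cases "even (Suc n)")
    case True
    have "s \<in> L" using s faithful_in_L by auto
    then show ?thesis using even_case[OF True] that bracket_closed by blast
  next
    case False
    have sL: "s \<in> L" using s faithful_in_L by auto
    then have syL: "bracket s y \<in> L" using y by (rule bracket_closed)
    have \<delta>sy: "?\<delta> s y = 0"
      using \<delta>_commute[OF sL y] faithful[OF s y] by simp
    \<comment> \<open>The innermost entries \<open>s\<close> and \<open>y\<close> merge into
      \<open>bracket s y\<close>, since \<open>?\<delta> s y = 0\<close>. For odd \<open>N\<close>
      the \<open>n\<close> copies of \<open>t\<close> between \<open>x\<close> and \<open>s\<close>
      are even in number and contribute no defect; for \<open>N = 3\<close> there are none.\<close>
    show ?thesis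
    proof (cases n)
      case 0
      have "iterated_defect \<phi> [x, s] y = 0"
        by (rule star) (use 0 that sL in auto)
      then show ?thesis using \<delta>sy by simp
    next
      case (Suc m)
      have "iterated_defect \<phi> (x # replicate n t @ [s]) y = 0"
        by (rule star) (use rep_in[of n] that sL in auto)
      moreover have "iterated_defect \<phi> (x # replicate n t @ [s]) y
          = iterated_defect \<phi> (x # replicate n t) (bracket s y)"
        using iterated_defect_append[of \<phi> "x # replicate n t" s y]
        by (simp add: \<delta>sy foldr_replicate_bracket)
      moreover have "iterated_defect \<phi> (replicate n t) (bracket s y) = 0"
        using replicate[OF k(2) syL k(2,1) syL, of n] False by simp
      ultimately have "?\<delta> x (of_int k ^ n \<odot> bracket s y) = 0"
        by (simp add: foldr_replicate_bracket funpow_eigenspace[OF k(2)])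
      then show ?thesis using \<delta>_scale[OF that(1) syL] k(1) by simp
    qed
  qed

  have zero_part: "?\<delta> x y = 0" if x: "x \<in> L" "x \<in> eigenspace t 0" and y: "y \<in> L" "y \<in> eigenspace t 0" for x y
  proof -
    have xy: "bracket x y = 0" using zero_part_abelian x y by blast
    \<comment> \<open>Here \<open>x\<close> and \<open>y\<close> are the two innermost entries.
      Because they commute, only the defect of the pair survives, under \<open>n + 1\<close>
      applications of \<open>ad t\<close>.\<close>
    have "iterated_defect \<phi> (replicate (Suc n) t @ [x]) y = 0"
      by (rule star) (use rep_in[of "Suc n"] that in auto)
    then have "iterated_defect \<phi> (replicate (Suc n) t) 0 + (bracket t ^^ Suc n) (?\<delta> x y) = 0"
      unfolding iterated_defect_append xy foldr_replicate_bracket .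
    moreover have "?\<delta> t 0 = 0"
      using \<delta>_scale[OF t_in subspace_0[OF subspace_L], of 0] by simp
    then have "iterated_defect \<phi> (replicate m t) 0 = 0" for m
      by (induction m) (simp_all add: foldr_replicate_bracket)
    ultimately have "(bracket t ^^ Suc n) (?\<delta> x y) = 0" by (simp only: add_0_left)
    \<comment> \<open>The annihilating polynomial is the monomial of exponent \<open>n + 1\<close>,
      whose only root is 0.\<close>
    then have kernel: "(\<Sum>i<Suc (Suc n). (if i = Suc n then 1 else 0) \<odot> (bracket t ^^ i) (?\<delta> x y)) = 0"
      by (simp add: if_distrib[of "\<lambda>c. c \<odot> _"] sum.delta cong: if_cong del: sum.lessThan_Suc funpow.simps)
    have nonzero: "(\<Sum>i<Suc (Suc n). (if i = Suc n then 1 else 0) * of_int m ^ i) \<noteq> (0 :: complex)"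
      if "m \<noteq> 0" for m
      using that by simp
    have "?\<delta> x y \<in> span (\<Union>m. eigenspace t m)"
      using in_L[OF x(1) y(1)] subset_span_eigenspaces by auto
    then have E0: "?\<delta> x y \<in> eigenspace t 0"
      by (rule polynomial_kernel_in_eigenspace[OF _ kernel nonzero])
    let ?V = "span (\<Union>m\<in>-{0}. eigenspace t m)"
    \<comment> \<open>Bracketing with \<open>u\<close> preserves degrees and kills the degree 0
      component of \<open>z\<close>, so the result has components of nonzero degree only.\<close>
    have V: "bracket u z \<in> ?V" if u: "u \<in> L" "u \<in> eigenspace t 0" and "z \<in> L" for u z
    proof -
      have "z \<in> {z \<in> L. bracket u z \<in> ?V}"
      proof (rule span_induct_generated[OF \<open>z \<in> L\<close>])
        show "subspace {z \<in> L. bracket u z \<in> ?V}"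
          using subspace_L subspace_span[of "\<Union>m\<in>-{0}. eigenspace t m"]
          unfolding subspace_def by (auto simp: bracket_add_right bracket_scale_right)
        show "L \<inter> eigenspace t 0 \<subseteq> {z \<in> L. bracket u z \<in> ?V}"
          using zero_part_abelian[OF u] by (auto simp: span_zero)
        have homogeneous: "z \<in> {z \<in> L. bracket u z \<in> ?V}"
          if "z \<in> L" "z \<in> eigenspace t k" "k \<noteq> 0" for z k
          using eigenspace_bracket[OF u(2) that(2)] that by (auto intro!: span_base)
        show "faithful_vectors L t \<subseteq> {z \<in> L. bracket u z \<in> ?V}"
          using homogeneous unfolding faithful_vectors_def by blast
        show "bracket s y \<in> {z \<in> L. bracket u z \<in> ?V}"
          if "s \<in> faithful_vectors L t" "y \<in> L" "k \<noteq> 0" "bracket s y \<in> eigenspace t k" for s y k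
          using homogeneous[OF bracket_closed that(4,3)] that unfolding faithful_vectors_def by blast
      qed
      then show ?thesis by simp
    qed
    have "?\<delta> x y = bracket y (\<phi> x) - bracket x (\<phi> y)"
      by (simp add: defect_def xy \<phi>0 bracket_commute[of "\<phi> x" y])
    then have "?\<delta> x y \<in> ?V"
      using V[OF x \<phi>(1)[OF y(1)]] V[OF y \<phi>(1)[OF x(1)]] by (simp add: span_diff)
    then show ?thesis using eigenspace_inter_span[OF E0] by simp
  qed

  have zero_left: "?\<delta> x z = 0" if x: "x \<in> L" "x \<in> eigenspace t 0" and "z \<in> L" for x z
  proof -
    have "z \<in> {z \<in> L. ?\<delta> x z = 0}"
      by (rule span_induct_generated[OF \<open>z \<in> L\<close> sub[OF x(1)]])
        (use zero_part[OF x] faithful[OF _ x(1)] generator_bracket[OF x(1)] bracket_closed faithful_in_L in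
          \<open>auto dest: subsetD\<close>)
    then show ?thesis by simp
  qed
  \<comment> \<open>Antisymmetry of the defect turns \<open>zero_left\<close> into the case still
    missing for arbitrary \<open>x\<close>, namely \<open>z\<close> in the degree 0 part of the
    spanning set.\<close>
  have zero_right: "?\<delta> x z = 0" if "x \<in> L" "z \<in> L" "z \<in> eigenspace t 0" for x z
    using zero_left[OF that(2,3,1)] \<delta>_commute[OF that(1,2)] by simp
  have "?\<delta> x z = 0" if x: "x \<in> L" and "z \<in> L" for x z
  proof -
    have "z \<in> {z \<in> L. ?\<delta> x z = 0}"
      by (rule span_induct_generated[OF \<open>z \<in> L\<close> sub[OF x]])
        (use zero_right[OF x] faithful[OF _ x] generator_bracket[OF x] bracket_closed faithful_in_L in
          \<open>auto dest: subsetD\<close>)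
    then show ?thesis by simp
  qed
  then show ?thesis using endo by (simp add: derivations_iff_defect)
qed

lemma N_derivations_eq_derivations:
  assumes "N \<ge> 3"
  shows "N_derivations N L = derivations L"
proof
  show "N_derivations N L \<subseteq> derivations L" using N_derivation_is_derivation[OF assms] by blast
  obtain n where "N = Suc n" using assms by (cases N) auto
  then show "derivations L \<subseteq> N_derivations N L"
    using derivations_subset_N_derivations[of L n] bracket_closed by simp
qed

end

subsection \<open>Triangular decomposition\<close>

context lie_algebra
begin

text \<open>Monomials of length at least one. Applied to the \<open>e i\<close> and to the
  \<open>f i\<close>, their spans play the role of the two nilpotent parts in the triangular
  decomposition.\<close>

inductive_set right_normed_words :: "('i \<Rightarrow> 'g) \<Rightarrow> 'g set" for e where
  generator: "e i \<in> right_normed_words e"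
| bracket: "y \<in> right_normed_words e \<Longrightarrow> bracket (e i) y \<in> right_normed_words e"

lemma right_normed_words_eigenvector:
  assumes "\<And>i. \<exists>a. bracket x (e i) = a \<odot> e i" and "y \<in> right_normed_words e"
  shows "\<exists>a. bracket x y = a \<odot> y"
  using assms(2)
proof induction
  case (generator i)
  show ?case by (rule assms(1))
next
  case (bracket y i)
  then obtain a b where "bracket x (e i) = a \<odot> e i" "bracket x y = b \<odot> y"
    using assms(1) by blast
  then have "bracket x (bracket (e i) y) = (a + b) \<odot> bracket (e i) y"
    by (simp add: bracket_bracket[of x] bracket_scale_left bracket_scale_right scale_left_distrib)
  then show ?case by blast
qed

text \<open>Degrees add up and every generator has degree at least \<open>m\<close>, so a word with
  two or more letters has degree at least \<open>2 * m\<close>.\<close>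

lemma right_normed_words_degree:
  assumes "\<And>i. bracket t (e i) = of_nat (d i) \<odot> e i" and "\<And>i. m \<le> d i"
    and "y \<in> right_normed_words e"
  shows "\<exists>k\<ge>m. y \<in> eigenspace t (int k) \<and> (k < 2 * m \<longrightarrow> (\<exists>i. y = e i \<and> k = d i))"
  using assms(3)
proof induction
  case (generator i)
  show ?case using assms(1,2) by (intro exI[of _ "d i"]) (auto simp: eigenspace_def)
next
  case (bracket y i)
  then obtain k where k: "k \<ge> m" "y \<in> eigenspace t (int k)" by blast
  have "e i \<in> eigenspace t (int (d i))" using assms(1) by (simp add: eigenspace_def)
  then have "bracket (e i) y \<in> eigenspace t (int (d i + k))"
    using eigenspace_bracket[OF _ k(2)] by simp
  moreover have "d i + k \<ge> 2 * m" using assms(2)[of i] k(1) by simp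
  ultimately show ?case by (intro exI[of _ "d i + k"]) auto
qed

text \<open>Here \<open>x\<close> is a generator of the opposite sign and \<open>T\<close> the
  torus. In \<open>[x, [e i, y]] = [[x, e i], y] + [e i, [x, y]]\<close> the first term is a
  multiple of \<open>y\<close>, and the second is handled by induction, since \<open>e i\<close>
  maps torus elements to multiples of itself and words to words.\<close>

lemma right_normed_words_lower:
  assumes "subspace T" and T: "\<And>h i. h \<in> T \<Longrightarrow> \<exists>a. bracket h (e i) = a \<odot> e i"
    and x: "\<And>i. bracket x (e i) \<in> T" and "y \<in> right_normed_words e"
  shows "bracket x y \<in> span (T \<union> right_normed_words e)"
  using assms(4)
proof induction
  case (generator i)
  show ?case using x by (intro span_base) auto
next
  case (bracket y i)
  obtain a where "bracket (bracket x (e i)) y = a \<odot> y"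
    using right_normed_words_eigenvector[OF T[OF x] bracket.hyps] by blast
  then have "bracket (bracket x (e i)) y \<in> span (T \<union> right_normed_words e)"
    using bracket.hyps by (auto intro: span_scale span_base)
  moreover have "bracket (e i) (bracket x y) \<in> span (T \<union> right_normed_words e)"
  proof (rule bracket_in_subspace_span[OF bracket.IH subspace_span])
    fix b assume "b \<in> T \<union> right_normed_words e"
    then show "bracket (e i) b \<in> span (T \<union> right_normed_words e)"
    proof
      assume "b \<in> T"
      then obtain a where "bracket b (e i) = a \<odot> e i" using T by blast
      then have "bracket (e i) b = (- a) \<odot> e i" by (simp add: bracket_commute[of "e i" b])
      then show ?thesis
        by (metis UnI2 right_normed_words.generator span_base span_scale)
    qed (auto intro: span_base right_normed_words.bracket)
  qed
  ultimately show ?case by (subst bracket_bracket) (rule span_add)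
qed

end

text \<open>The bounds on \<open>d\<close> make \<open>d i\<close> smaller than any sum of two of its values, so that
  the eigenspaces of \<open>\<iota> h0\<close> for \<open>\<plusminus> d i\<close> are spanned by one generator each.\<close>

locale chevalley_generators = lie_algebra scale bracket
  for scale :: "complex \<Rightarrow> 'g::ab_group_add \<Rightarrow> 'g" (infixr \<open>\<odot>\<close> 75)
    and bracket :: "'g \<Rightarrow> 'g \<Rightarrow> 'g" +
  fixes \<iota> :: "'h \<Rightarrow> 'g" and e f c :: "'i::finite \<Rightarrow> 'g" and root :: "'i \<Rightarrow> 'h \<Rightarrow> complex"
    and h0 :: 'h and d :: "'i \<Rightarrow> nat" and m :: nat
  assumes subspace_range: "subspace (range \<iota>)"
    and torus_abelian: "bracket (\<iota> h) (\<iota> h') = 0"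
    and torus_e: "bracket (\<iota> h) (e i) = root i h \<odot> e i"
    and torus_f: "bracket (\<iota> h) (f i) = (- root i h) \<odot> f i"
    and e_f: "bracket (e i) (f j) = (if i = j then c i else 0)"
    and c_in: "c i \<in> range \<iota>"
    and c_e: "bracket (c i) (e i) = 2 \<odot> e i"
    and c_f: "bracket (c i) (f i) = (- 2) \<odot> f i"
    and root_h0: "root i h0 = of_nat (d i)"
    and d_ge: "m \<le> d i" and d_less: "d i < 2 * m" and inj_d: "inj d"
    and generated_by: "subspace V \<Longrightarrow> range \<iota> \<subseteq> V \<Longrightarrow> range e \<subseteq> V \<Longrightarrow> range f \<subseteq> V \<Longrightarrow>
      (\<And>x y. x \<in> V \<Longrightarrow> y \<in> V \<Longrightarrow> bracket x y \<in> V) \<Longrightarrow> V = UNIV"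
begin

abbreviation "t \<equiv> \<iota> h0"

abbreviation "homogeneous_generators \<equiv> range \<iota> \<union> right_normed_words e \<union> right_normed_words f"

lemma d_pos: "d i > 0"
  using d_ge[of i] d_less[of i] by simp

lemma torus_eigen_e: "h \<in> range \<iota> \<Longrightarrow> \<exists>a. bracket h (e i) = a \<odot> e i"
  and torus_eigen_f: "h \<in> range \<iota> \<Longrightarrow> \<exists>a. bracket h (f i) = a \<odot> f i"
  by (metis rangeE torus_e) (metis rangeE torus_f)

lemma torus_generators:
  assumes "h \<in> range \<iota>" and "y \<in> homogeneous_generators"
  shows "\<exists>a. bracket h y = a \<odot> y"
  using assms(2)
proof (elim UnE)
  assume "y \<in> range \<iota>"
  then have "bracket h y = 0 \<odot> y" using assms(1) torus_abelian by auto
  then show ?thesis ..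
next
  assume "y \<in> right_normed_words e"
  then show ?thesis by (rule right_normed_words_eigenvector[OF torus_eigen_e[OF assms(1)]])
next
  assume "y \<in> right_normed_words f"
  then show ?thesis by (rule right_normed_words_eigenvector[OF torus_eigen_f[OF assms(1)]])
qed

lemma e_f_range: "bracket (e i) (f j) \<in> range \<iota>" "bracket (f i) (e j) \<in> range \<iota>"
  using c_in subspace_0[OF subspace_range] subspace_neg[OF subspace_range, of "c _"]
  by (auto simp: e_f bracket_commute[of "f i"])

text \<open>The elements of the span whose bracket with the span stays inside it form a subalgebra.
  It contains the torus and all \<open>e i\<close> and \<open>f i\<close>, hence is
  everything.\<close>

lemma triangular_decomposition: "span homogeneous_generators = UNIV" (is "?M = UNIV")
proof -
  let ?V = "{x \<in> ?M. \<forall>y\<in>?M. bracket x y \<in> ?M}"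
  have base: "x \<in> ?V" if "x \<in> homogeneous_generators"
    and "\<And>y. y \<in> homogeneous_generators \<Longrightarrow> bracket x y \<in> ?M" for x
    using that bracket_in_subspace_span[OF _ subspace_span, of _ homogeneous_generators x]
    by (auto intro: span_base)
  have mono: "x \<in> ?M" if "x \<in> span (range \<iota> \<union> right_normed_words e) \<or> x \<in> span (range \<iota> \<union> right_normed_words f)" for x
    using that span_mono[of "range \<iota> \<union> right_normed_words e" homogeneous_generators]
      span_mono[of "range \<iota> \<union> right_normed_words f" homogeneous_generators] by auto
  have ad_torus: "bracket y h \<in> ?M" if hy: "h \<in> range \<iota>" "y \<in> homogeneous_generators" for h y
  proof -
    obtain a where "bracket y h = (- a) \<odot> y"
      using torus_generators[OF hy] by (metis bracket_commute scale_minus_left)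
    then show ?thesis using hy(2) span_scale span_base by metis
  qed
  have "?V = UNIV"
  proof (rule generated_by)
    show "subspace ?V"
      using subspace_span[of homogeneous_generators]
      unfolding subspace_def by (auto simp: bracket_add_left bracket_scale_left)
    show "range \<iota> \<subseteq> ?V"
    proof
      fix h assume h: "h \<in> range \<iota>"
      show "h \<in> ?V"
      proof (rule base)
        fix y assume y: "y \<in> homogeneous_generators"
        then obtain a where "bracket h y = a \<odot> y" using torus_generators[OF h] by blast
        then show "bracket h y \<in> ?M" using y span_scale span_base by metis
      qed (use h in auto)
    qed
    show "range e \<subseteq> ?V"
    proof
      fix x assume "x \<in> range e"
      then obtain i where x: "x = e i" by auto
      have xg: "x \<in> homogeneous_generators"
        unfolding x by (simp add: right_normed_words.generator)
      show "x \<in> ?V"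
      proof (rule base[OF xg])
        fix y assume "y \<in> homogeneous_generators"
        \<comment> \<open>A generator \<open>e i\<close> sends a torus element to a multiple of
          \<open>e i\<close>, lengthens a word in the \<open>e j\<close> and lowers a word in the
          \<open>f j\<close>.\<close>
        then consider "y \<in> range \<iota>" | "y \<in> right_normed_words e" | "y \<in> right_normed_words f" by auto
        then show "bracket x y \<in> ?M"
        proof cases
          case 2
          then show ?thesis unfolding x by (auto intro: span_base right_normed_words.bracket)
        next
          case 3
          then show ?thesis unfolding x
            by (intro mono disjI2 right_normed_words_lower subspace_range torus_eigen_f e_f_range)
        qed (use ad_torus xg in blast)
      qed
    qed
    show "range f \<subseteq> ?V"
    proof
      fix x assume "x \<in> range f"
      then obtain i where x: "x = f i" by auto
      have xg: "x \<in> homogeneous_generators"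
        unfolding x by (simp add: right_normed_words.generator)
      show "x \<in> ?V"
      proof (rule base[OF xg])
        fix y assume "y \<in> homogeneous_generators"
        then consider "y \<in> range \<iota>" | "y \<in> right_normed_words e" | "y \<in> right_normed_words f" by auto
        then show "bracket x y \<in> ?M"
        proof cases
          case 2
          then show ?thesis unfolding x
            by (intro mono disjI1 right_normed_words_lower subspace_range torus_eigen_e e_f_range)
        next
          case 3
          then show ?thesis unfolding x by (auto intro: span_base right_normed_words.bracket)
        qed (use ad_torus xg in blast)
      qed
    qed
    show "bracket x y \<in> ?V" if "x \<in> ?V" "y \<in> ?V" for x y
    proof -
      have "bracket (bracket x y) z \<in> ?M" if "z \<in> ?M" for z
      proof -
        have "bracket (bracket x y) z = bracket x (bracket y z) - bracket y (bracket x z)"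
          using bracket_bracket[of x y z] by simp
        then show ?thesis using \<open>x \<in> ?V\<close> \<open>y \<in> ?V\<close> that by (auto intro: span_diff)
      qed
      then show ?thesis using that by auto
    qed
  qed
  then show ?thesis by auto
qed

section \<open>The grading by the eigenvalues of ad t\<close>

lemma torus_degree: "range \<iota> \<subseteq> eigenspace t 0"
  using torus_abelian by (auto simp: eigenspace_def)

lemma e_words_degree:
  assumes "y \<in> right_normed_words e"
  shows "\<exists>k\<ge>m. y \<in> eigenspace t (int k) \<and> (k < 2 * m \<longrightarrow> (\<exists>i. y = e i \<and> k = d i))"
  by (rule right_normed_words_degree[OF _ d_ge assms]) (simp add: torus_e root_h0)

lemma f_words_degree:
  assumes "y \<in> right_normed_words f"
  shows "\<exists>k\<ge>m. y \<in> eigenspace t (- int k) \<and> (k < 2 * m \<longrightarrow> (\<exists>i. y = f i \<and> k = d i))"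
  using right_normed_words_degree[where t = "- t" and e = f, OF _ d_ge assms]
  by (simp add: torus_f root_h0 bracket_minus_left eigenspace_minus)

lemma m_pos: "m > 0"
  using d_less[of undefined] by simp

lemma eigenspace_in_span:
  assumes "B \<subseteq> eigenspace t a"
    and "\<And>y k. y \<in> homogeneous_generators \<Longrightarrow> y \<in> B \<or> (\<exists>k\<noteq>a. y \<in> eigenspace t k)"
  shows "eigenspace t a \<subseteq> span B"
proof
  fix x assume x: "x \<in> eigenspace t a"
  have "homogeneous_generators \<subseteq> B \<union> (\<Union>k\<in>-{a}. eigenspace t k)"
    using assms(2) by blast
  then have "x \<in> span (B \<union> (\<Union>k\<in>-{a}. eigenspace t k))"
    using span_mono triangular_decomposition by blast
  then show "x \<in> span B" using eigenspace_subset_span[OF x _ assms(1)] by blast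
qed

lemma eigenspace_zero: "eigenspace t 0 = range \<iota>"
proof -
  have "eigenspace t 0 \<subseteq> span (range \<iota>)"
  proof (rule eigenspace_in_span[OF torus_degree])
    fix y assume "y \<in> homogeneous_generators"
    then show "y \<in> range \<iota> \<or> (\<exists>k\<noteq>0. y \<in> eigenspace t k)"
    proof (elim UnE)
      assume "y \<in> right_normed_words e"
      then obtain k where "k \<ge> m" "y \<in> eigenspace t (int k)" using e_words_degree by blast
      then show ?thesis using m_pos by (intro disjI2 exI[of _ "int k"]) auto
    next
      assume "y \<in> right_normed_words f"
      then obtain k where "k \<ge> m" "y \<in> eigenspace t (- int k)" using f_words_degree by blast
      then show ?thesis using m_pos by (intro disjI2 exI[of _ "- int k"]) auto
    qed auto
  qed
  moreover have "span (range \<iota>) = range \<iota>" by (simp add: span_eq_iff subspace_range)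
  ultimately show ?thesis using torus_degree by auto
qed

lemma e_degree: "e i \<in> eigenspace t (int (d i))"
  and f_degree: "f i \<in> eigenspace t (- int (d i))"
  by (simp_all add: eigenspace_def torus_e torus_f root_h0)

text \<open>Since \<open>d i < 2 * m\<close>, a word of this degree is a single \<open>e j\<close>
  with \<open>d j = d i\<close>, and \<open>d\<close> is injective.\<close>

lemma eigenspace_simple_root: "eigenspace t (int (d i)) \<subseteq> span {e i}"
proof (rule eigenspace_in_span)
  fix y assume "y \<in> homogeneous_generators"
  then show "y \<in> {e i} \<or> (\<exists>k\<noteq>int (d i). y \<in> eigenspace t k)"
  proof (elim UnE)
    assume "y \<in> range \<iota>"
    then show ?thesis using torus_degree d_pos[of i] by (intro disjI2 exI[of _ 0]) auto
  next
    assume "y \<in> right_normed_words e"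
    then obtain k where k: "y \<in> eigenspace t (int k)" "k < 2 * m \<longrightarrow> (\<exists>i. y = e i \<and> k = d i)"
      using e_words_degree by blast
    show ?thesis
    proof (cases "k = d i")
      case True
      then show ?thesis using k(2) d_less[of i] injD[OF inj_d] by auto
    next
      case False
      then show ?thesis using k(1) by (intro disjI2 exI[of _ "int k"]) auto
    qed
  next
    assume "y \<in> right_normed_words f"
    then obtain k where "k \<ge> m" "y \<in> eigenspace t (- int k)" using f_words_degree by blast
    then show ?thesis using m_pos by (intro disjI2 exI[of _ "- int k"]) auto
  qed
qed (simp add: e_degree)

lemma eigenspace_negative_simple_root: "eigenspace t (- int (d i)) \<subseteq> span {f i}"
proof (rule eigenspace_in_span)
  fix y assume "y \<in> homogeneous_generators"
  then show "y \<in> {f i} \<or> (\<exists>k\<noteq>- int (d i). y \<in> eigenspace t k)"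
  proof (elim UnE)
    assume "y \<in> range \<iota>"
    then show ?thesis using torus_degree d_pos[of i] by (intro disjI2 exI[of _ 0]) auto
  next
    assume "y \<in> right_normed_words f"
    then obtain k where k: "y \<in> eigenspace t (- int k)" "k < 2 * m \<longrightarrow> (\<exists>i. y = f i \<and> k = d i)"
      using f_words_degree by blast
    show ?thesis
    proof (cases "k = d i")
      case True
      then show ?thesis using k(2) d_less[of i] injD[OF inj_d] by auto
    next
      case False
      then show ?thesis using k(1) by (intro disjI2 exI[of _ "- int k"]) auto
    qed
  next
    assume "y \<in> right_normed_words e"
    then obtain k where "k \<ge> m" "y \<in> eigenspace t (int k)" using e_words_degree by blast
    then show ?thesis using m_pos by (intro disjI2 exI[of _ "int k"]) auto
  qed
qed (simp add: f_degree)

lemma e_faithful: "e i \<in> faithful_vectors UNIV t"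
proof -
  have "w = 0" if w: "w \<in> eigenspace t (- int (d i))" "bracket (e i) w = 0" for w
  proof -
    obtain a where a: "w = a \<odot> f i"
      using w(1) eigenspace_negative_simple_root[of i] by (auto simp: span_singleton)
    then have "a \<odot> c i = 0" using w(2) by (simp only: bracket_scale_right e_f simp_thms if_True)
    \<comment> \<open>Bracketing with \<open>f i\<close> turns \<open>a \<odot> c i = 0\<close> into
      \<open>- 2 a f_i = 0\<close>, which is \<open>w = 0\<close> whether or not \<open>f i\<close>
      itself vanishes.\<close>
    then have "bracket (a \<odot> c i) (f i) = 0" by (simp only: bracket_zero_left)
    then show ?thesis unfolding a by (simp add: bracket_scale_left c_f)
  qed
  then show ?thesis unfolding faithful_vectors_def
    using e_degree[of i] d_pos[of i] by (auto intro!: exI[of _ "int (d i)"])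
qed

lemma f_faithful: "f i \<in> faithful_vectors UNIV t"
proof -
  have "w = 0" if w: "w \<in> eigenspace t (int (d i))" "bracket (f i) w = 0" for w
  proof -
    obtain a where a: "w = a \<odot> e i"
      using w(1) eigenspace_simple_root[of i] by (auto simp: span_singleton)
    then have "bracket (a \<odot> c i) (e i) = 0"
      using w(2) by (auto simp: bracket_scale_right bracket_commute[of "f i"] e_f)
    then show ?thesis unfolding a by (simp add: bracket_scale_left c_e)
  qed
  then show ?thesis unfolding faithful_vectors_def
    using f_degree[of i] d_pos[of i] by (auto intro!: exI[of _ "- int (d i)"])
qed

text \<open>The triangular decomposition supplies the spanning set: the torus has degree 0, single
  generators are faithful, and a longer word is a generator bracketed with a word, of nonzero
  degree.\<close>

lemma graded_UNIV: "graded_subalgebra scale bracket UNIV t"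
proof
  let ?S = "faithful_vectors UNIV t"
  let ?G = "(UNIV \<inter> eigenspace t 0) \<union> ?S \<union>
    {bracket s y | s y k. s \<in> ?S \<and> y \<in> UNIV \<and> k \<noteq> 0 \<and> bracket s y \<in> eigenspace t k}"
  show "bracket x y = 0" if "x \<in> eigenspace t 0" "y \<in> eigenspace t 0" for x y
    using that torus_abelian unfolding eigenspace_zero by auto
  have "homogeneous_generators \<subseteq> ?G"
  proof (intro Un_least)
    show "range \<iota> \<subseteq> ?G" using torus_degree by auto
    show "right_normed_words e \<subseteq> ?G"
    proof
      fix y assume y: "y \<in> right_normed_words e"
      then obtain k where k: "k \<ge> m" "y \<in> eigenspace t (int k)" using e_words_degree by blast
      from y show "y \<in> ?G"
      proof cases
        case (bracket z i)
        have "int k \<noteq> 0" using k m_pos by simp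
        then show ?thesis using e_faithful[of i] bracket k(2) by blast
      qed (use e_faithful in auto)
    qed
    show "right_normed_words f \<subseteq> ?G"
    proof
      fix y assume y: "y \<in> right_normed_words f"
      then obtain k where k: "k \<ge> m" "y \<in> eigenspace t (- int k)" using f_words_degree by blast
      from y show "y \<in> ?G"
      proof cases
        case (bracket z i)
        have "- int k \<noteq> 0" using k m_pos by simp
        then show ?thesis using f_faithful[of i] bracket k(2) by blast
      qed (use f_faithful in auto)
    qed
  qed
  then have "span homogeneous_generators \<subseteq> span ?G" by (rule span_mono)
  then show "UNIV \<subseteq> span ?G" unfolding triangular_decomposition .
qed auto

section \<open>Borel subalgebras\<close>

definition dominant_weight_vectors :: "'g set" where
  "dominant_weight_vectors =
     {x. \<exists>k :: 'i \<Rightarrow> nat. \<forall>h. bracket (\<iota> h) x = (\<Sum>i\<in>UNIV. of_nat (k i) * root i h) \<odot> x}"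

lemma dominant_weight_vectors_bracket:
  assumes "x \<in> dominant_weight_vectors" and "y \<in> dominant_weight_vectors"
  shows "bracket x y \<in> dominant_weight_vectors"
proof -
  obtain j k :: "'i \<Rightarrow> nat"
    where j: "\<And>h. bracket (\<iota> h) x = (\<Sum>i\<in>UNIV. of_nat (j i) * root i h) \<odot> x"
      and k: "\<And>h. bracket (\<iota> h) y = (\<Sum>i\<in>UNIV. of_nat (k i) * root i h) \<odot> y"
    using assms unfolding dominant_weight_vectors_def by auto
  have "bracket (\<iota> h) (bracket x y) = (\<Sum>i\<in>UNIV. of_nat (j i + k i) * root i h) \<odot> bracket x y" for h
    unfolding bracket_bracket[of "\<iota> h"] j k
    by (simp add: bracket_scale_left bracket_scale_right distrib_right sum.distrib scale_left_distrib)
  then show ?thesis unfolding dominant_weight_vectors_def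
    by (intro CollectI exI[of _ "\<lambda>i. j i + k i"] allI)
qed

lemma dominant_weight_vectors_degree:
  assumes "x \<in> dominant_weight_vectors"
  obtains k :: nat where "x \<in> eigenspace t (int k)"
proof -
  obtain k :: "'i \<Rightarrow> nat" where "bracket t x = (\<Sum>i\<in>UNIV. of_nat (k i) * root i h0) \<odot> x"
    using assms unfolding dominant_weight_vectors_def by auto
  then have "x \<in> eigenspace t (int (\<Sum>i\<in>UNIV. k i * d i))"
    by (simp add: eigenspace_def root_h0)
  then show ?thesis by (rule that)
qed

text \<open>All degrees are nonnegative here, so the space opposite to a positive degree is zero and
  every spanning weight vector of positive degree is faithful.\<close>

lemma graded_borel: "graded_subalgebra scale bracket (span dominant_weight_vectors) t"
proof
  let ?L = "span dominant_weight_vectors"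
  let ?S = "faithful_vectors ?L t"
  show "subspace ?L" by (rule subspace_span)
  show "bracket x y \<in> ?L" if "x \<in> ?L" "y \<in> ?L" for x y
  proof (rule bracket_in_subspace_span[OF that(2) subspace_span])
    fix b assume b: "b \<in> dominant_weight_vectors"
    have "bracket b x \<in> ?L"
      by (rule bracket_in_subspace_span[OF that(1) subspace_span])
        (rule span_base[OF dominant_weight_vectors_bracket[OF b]])
    then show "bracket x b \<in> ?L" unfolding bracket_commute[of x] by (rule span_neg)
  qed
  have "t \<in> dominant_weight_vectors"
    unfolding dominant_weight_vectors_def using torus_abelian
    by (auto intro!: exI[of _ "\<lambda>_. 0"])
  then show "t \<in> ?L" by (rule span_base)
  show "bracket x y = 0" if "x \<in> eigenspace t 0" "y \<in> eigenspace t 0" for x y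
    using that torus_abelian unfolding eigenspace_zero by auto
  have "dominant_weight_vectors \<subseteq> (\<Union>k\<in>{0..}. eigenspace t k)"
  proof
    fix x assume "x \<in> dominant_weight_vectors"
    then obtain k where "x \<in> eigenspace t (int k)" by (rule dominant_weight_vectors_degree)
    then show "x \<in> (\<Union>k\<in>{0..}. eigenspace t k)" by (intro UN_I[of "int k"]) auto
  qed
  then have "?L \<subseteq> span (\<Union>k\<in>{0..}. eigenspace t k)" by (rule span_mono)
  then have no_negative: "w = 0" if "w \<in> ?L" "w \<in> eigenspace t (- int k)" "k > 0" for w k
    using eigenspace_inter_span[OF that(2), of "{0..}"] that(1,3) by auto
  have "dominant_weight_vectors \<subseteq> (?L \<inter> eigenspace t 0) \<union> ?S"
  proof
    fix x assume x: "x \<in> dominant_weight_vectors"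
    then obtain k where k: "x \<in> eigenspace t (int k)" by (rule dominant_weight_vectors_degree)
    show "x \<in> (?L \<inter> eigenspace t 0) \<union> ?S"
    proof (cases "k = 0")
      case True
      then show ?thesis using k span_base[OF x] by simp
    next
      case False
      then have "x \<in> ?S" unfolding faithful_vectors_def
        using k span_base[OF x] no_negative[of _ k]
        by (intro CollectI exI[of _ "int k"]) auto
      then show ?thesis by (rule UnI2)
    qed
  qed
  then show "?L \<subseteq> span ((?L \<inter> eigenspace t 0) \<union> ?S \<union>
    {bracket s y | s y k. s \<in> ?S \<and> y \<in> ?L \<and> k \<noteq> 0 \<and> bracket s y \<in> eigenspace t k})"
    by (rule span_mono[OF subset_trans[OF _ Un_upper1]])
qed

end

subsection \<open>Kac-Moody algebras\<close>

text \<open>If the image of \<open>h \<mapsto> (root i h)\<close> missed \<open>v\<close>, a linear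
  functional \<open>g\<close> vanishing on the image with \<open>g v = 1\<close> would give a linear
  relation among the simple roots.\<close>

lemma (in realization) roots_jointly_surjective: "\<exists>h. \<forall>i. root i h = v i"
proof (rule ccontr)
  assume no: "\<not> (\<exists>h. \<forall>i. root i h = v i)"
  interpret P: vector_space_pair "(*s) :: complex \<Rightarrow> complex^'i \<Rightarrow> complex^'i" "(*) :: complex \<Rightarrow> complex \<Rightarrow> complex"
    by unfold_locales (auto simp: algebra_simps)
  interpret F: vector_space "\<lambda>(c::complex) (f::'h \<Rightarrow> complex) h. c * f h"
    by (rule vector_space_functions)
  define T where "T h = (\<chi> i. root i h)" for h
  have root_add: "root i (x + y) = root i x + root i y"
    and root_scale: "root i (scaleh a x) = a * root i x" for i x y a
    using linear_root[of i] by (simp_all add: Vector_Spaces.linear_iff)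
  have "vec.subspace (range T)"
    unfolding vec.subspace_def
  proof (intro conjI allI ballI)
    have "T 0 = 0" using root_scale[of _ 0 0] by (simp add: T_def vec_eq_iff)
    then show "0 \<in> range T" by (metis rangeI)
    show "x + y \<in> range T" if xy: "x \<in> range T" "y \<in> range T" for x y
    proof -
      obtain h h' where "x = T h" "y = T h'" using xy by auto
      then have "x + y = T (h + h')" by (simp add: T_def vec_eq_iff root_add)
      then show ?thesis by simp
    qed
    show "a *s x \<in> range T" if x: "x \<in> range T" for a x
    proof -
      obtain h where "x = T h" using x by auto
      then have "a *s x = T (scaleh a h)" by (simp add: T_def vec_eq_iff root_scale)
      then show ?thesis by simp
    qed
  qed
  then obtain B where B: "B \<subseteq> range T" "vec.independent B" "range T = vec.span B"
    using vec.basis_exists[of "range T"] vec.span_minimal by (metis subset_antisym)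
  let ?v = "\<chi> i. v i"
  have "?v \<notin> range T" using no by (auto simp: T_def vec_eq_iff)
  then have "vec.independent (insert ?v B)" and vB: "?v \<notin> B"
    using B vec.independent_insertI[of ?v B] by auto
  then obtain g where g: "Vector_Spaces.linear (*s) (*) g"
    and gB: "\<And>x. x \<in> insert ?v B \<Longrightarrow> g x = (if x = ?v then 1 else 0)"
    using P.linear_independent_extend[of "insert ?v B" "\<lambda>x. if x = ?v then 1 else 0"] by blast
  interpret g: Vector_Spaces.linear "(*s)" "(*)" g by (rule g)
  have gT: "g (T h) = 0" for h
  proof (rule g.eq_0_on_span)
    show "T h \<in> vec.span B" using B by auto
    show "g x = 0" if "x \<in> B" for x using gB[of x] that vB by auto
  qed
  have g_expand: "g x = (\<Sum>i\<in>UNIV. x $ i * g (axis i 1))" for x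
    by (subst basis_expansion[of x, symmetric]) (simp only: g.sum g.scale)
  have sum_apply: "(\<Sum>i\<in>I. F i) h = (\<Sum>i\<in>I. F i h)" for I and F :: "'i \<Rightarrow> 'h \<Rightarrow> complex" and h
    by (induction I rule: infinite_finite_induct) simp_all
  \<comment> \<open>Independence is stated for the set \<open>range root\<close>, so the
    coefficients of \<open>g\<close> are indexed by roots, with \<open>inv root\<close> recovering
    the index.\<close>
  have "(\<Sum>r\<in>range root. (\<lambda>h. g (axis (inv root r) 1) * r h)) = 0"
  proof
    fix h
    have "(\<Sum>r\<in>range root. (\<lambda>h. g (axis (inv root r) 1) * r h)) h = (\<Sum>i\<in>UNIV. g (axis i 1) * root i h)"
      by (simp add: sum.reindex[OF inj_root] inv_f_f[OF inj_root] sum_apply)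
    also have "\<dots> = g (T h)" by (subst g_expand) (simp add: T_def mult.commute)
    finally show "(\<Sum>r\<in>range root. (\<lambda>h. g (axis (inv root r) 1) * r h)) h = 0 h"
      by (simp add: gT)
  qed
  then have "g (axis (inv root (root i)) 1) = 0" for i
    using F.independentD[OF independent_roots, of "range root" "\<lambda>r. g (axis (inv root r) 1)" "root i"]
    by auto
  then have "g ?v = 0" by (subst g_expand) (simp add: inv_f_f[OF inj_root])
  then show False using gB[of ?v] by simp
qed

section \<open>Chevalley generators of a Kac-Moody algebra\<close>

context kac_moody_algebra
begin

lemma relations:
  shows \<iota>_add: "\<iota> (h + h') = \<iota> h + \<iota> h'"
    and \<iota>_scale: "\<iota> (scaleh a h) = a \<odot> \<iota> h"
    and bracket_e_f_same: "bracket (e i) (f i) = \<iota> (coroot i)"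
    and bracket_e_f_diff: "i \<noteq> j \<Longrightarrow> bracket (e i) (f j) = 0"
    and bracket_\<iota>_\<iota>: "bracket (\<iota> h) (\<iota> h') = 0"
    and bracket_\<iota>_e: "bracket (\<iota> h) (e i) = root i h \<odot> e i"
    and bracket_\<iota>_f: "bracket (\<iota> h) (f i) = (- root i h) \<odot> f i"
proof -
  let ?ev = "eval_word (case_km_generator \<iota> e f)"
  have ev: "?ev s = ?ev t" if "km_relation A scaleh root coroot s t" for s t
    using presented lie_cong.rel[of "km_relation A scaleh root coroot", OF that]
    unfolding presented_by_def by blast
  show "\<iota> (h + h') = \<iota> h + \<iota> h'" using ev[OF km_relation.H_add] by simp
  show "\<iota> (scaleh a h) = a \<odot> \<iota> h" using ev[OF km_relation.H_scale] by simp
  show "bracket (e i) (f i) = \<iota> (coroot i)" using ev[OF km_relation.EF_same] by simp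
  show "bracket (e i) (f j) = 0" if "i \<noteq> j" using ev[OF km_relation.EF_diff[OF that]] by simp
  show "bracket (\<iota> h) (\<iota> h') = 0" using ev[OF km_relation.HH] by simp
  show "bracket (\<iota> h) (e i) = root i h \<odot> e i" using ev[OF km_relation.HE] by simp
  show "bracket (\<iota> h) (f i) = (- root i h) \<odot> f i" using ev[OF km_relation.HF] by simp
qed

lemma generated_by_generators:
  assumes "subspace V" "range \<iota> \<subseteq> V" "range e \<subseteq> V" "range f \<subseteq> V"
    and "\<And>x y. x \<in> V \<Longrightarrow> y \<in> V \<Longrightarrow> bracket x y \<in> V"
  shows "V = UNIV"
proof -
  have "eval_word (case_km_generator \<iota> e f) w \<in> V" for w
  proof (induction w)
    case (Gen x)
    then show ?case using assms(2-4) by (cases x) auto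
  qed (use assms(1,5) in \<open>auto intro: subspace_0 subspace_add subspace_scale\<close>)
  then show ?thesis using presented unfolding presented_by_def by (metis UNIV_eq_I surjD)
qed

lemma subspace_range_\<iota>: "subspace (range \<iota>)"
  unfolding subspace_def using \<iota>_add \<iota>_scale
  by (metis (no_types, lifting) rangeE rangeI scale_zero_left)

lemma \<iota>_minus: "\<iota> (- h) = - \<iota> h"
  using \<iota>_scale[of "-1" h] by (simp add: H.scale_minus_left)

lemma root_minus: "root i (- h) = - root i h"
  using H.linear_root[of i] H.scale_minus_left[of 1 h]
  by (metis H.scale_one Vector_Spaces.linear_iff mult_minus1)

text \<open>The second instance is the first one after exchanging \<open>e\<close> and
  \<open>f\<close> and negating roots, coroots and \<open>h0\<close>, as in the Chevalley
  involution; the degrees \<open>d\<close> stay the same. It lets the negative Borel subalgebra be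
  treated as a positive one.\<close>

lemma chevalley_generators_exist:
  obtains h0 d where
    "chevalley_generators scale bracket \<iota> e f (\<lambda>i. \<iota> (coroot i)) root h0 d CARD('i)"
    and "chevalley_generators scale bracket \<iota> f e (\<lambda>i. - \<iota> (coroot i)) (\<lambda>i h. - root i h) (- h0) d CARD('i)"
proof -
  obtain b where b: "bij_betw b (UNIV :: 'i set) {0..<CARD('i)}"
    using ex_bij_betw_finite_nat[of "UNIV :: 'i set"] by auto
  \<comment> \<open>The values are n, ..., 2n - 1 for n simple roots: distinct, and each below the
    sum of any two.\<close>
  define d where "d i = CARD('i) + b i" for i
  have d: "CARD('i) \<le> d i" "d i < 2 * CARD('i)" "inj d" for i
    using b bij_betw_apply[OF b, of i] unfolding d_def by (auto simp: bij_betw_def inj_on_def)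
  obtain h0 where h0: "\<And>i. root i h0 = of_nat (d i)"
    using H.roots_jointly_surjective[of "\<lambda>i. of_nat (d i)"] by blast
  have root_coroot: "root i (coroot i) = 2" for i
    using H.root_coroot[of i i] cartan_matrix by (simp add: generalized_cartan_matrix_def)
  show ?thesis
  proof
    show "chevalley_generators scale bracket \<iota> e f (\<lambda>i. \<iota> (coroot i)) root h0 d CARD('i)"
    proof unfold_locales
      show "V = UNIV" if "subspace V" "range \<iota> \<subseteq> V" "range e \<subseteq> V" "range f \<subseteq> V"
        "\<And>x y. x \<in> V \<Longrightarrow> y \<in> V \<Longrightarrow> bracket x y \<in> V" for V
        by (rule generated_by_generators) (use that in auto)
    qed (auto simp: subspace_range_\<iota> relations root_coroot h0 d)
    show "chevalley_generators scale bracket \<iota> f e (\<lambda>i. - \<iota> (coroot i)) (\<lambda>i h. - root i h) (- h0) d CARD('i)"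
    proof unfold_locales
      show "V = UNIV" if "subspace V" "range \<iota> \<subseteq> V" "range f \<subseteq> V" "range e \<subseteq> V"
        "\<And>x y. x \<in> V \<Longrightarrow> y \<in> V \<Longrightarrow> bracket x y \<in> V" for V
        by (rule generated_by_generators) (use that in auto)
      show "bracket (f i) (e j) = (if i = j then - \<iota> (coroot i) else 0)" for i j
        unfolding bracket_commute[of "f i"] by (simp add: relations)
      show "- \<iota> (coroot i) \<in> range \<iota>" for i
        by (metis \<iota>_minus rangeI)
    qed (auto simp: subspace_range_\<iota> relations root_coroot h0 d root_minus bracket_minus_left)
  qed
qed

lemma N_derivations_eq_derivations:
  assumes "N \<ge> 3"
  shows "N_derivations N UNIV = derivations UNIV"
    and "N_derivations N borel_plus = derivations borel_plus"
    and "N_derivations N borel_minus = derivations borel_minus"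
proof -
  obtain h0 d
    where pos: "chevalley_generators scale bracket \<iota> e f (\<lambda>i. \<iota> (coroot i)) root h0 d CARD('i)"
      and neg: "chevalley_generators scale bracket \<iota> f e (\<lambda>i. - \<iota> (coroot i)) (\<lambda>i h. - root i h) (- h0) d CARD('i)"
    by (rule chevalley_generators_exist)
  interpret pos: chevalley_generators scale bracket \<iota> e f "\<lambda>i. \<iota> (coroot i)" root h0 d "CARD('i)"
    by (rule pos)
  interpret neg: chevalley_generators scale bracket \<iota> f e "\<lambda>i. - \<iota> (coroot i)" "\<lambda>i h. - root i h" "- h0" d "CARD('i)"
    by (rule neg)
  have plus: "borel_plus = span pos.dominant_weight_vectors"
    unfolding borel_plus_def pos.dominant_weight_vectors_def Q_plus_def weight_space_def
    by (rule arg_cong[of _ _ span]) auto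
  \<comment> \<open>For the exchanged data the roots change sign, so their nonnegative combinations
    are the negatives of the elements of \<open>Q_plus\<close>.\<close>
  have minus: "borel_minus = span neg.dominant_weight_vectors"
    unfolding borel_minus_def neg.dominant_weight_vectors_def Q_plus_def weight_space_def
    by (rule arg_cong[of _ _ span]) (auto simp: sum_negf)
  show "N_derivations N UNIV = derivations UNIV"
    using graded_subalgebra.N_derivations_eq_derivations[OF pos.graded_UNIV assms] .
  show "N_derivations N borel_plus = derivations borel_plus"
    using graded_subalgebra.N_derivations_eq_derivations[OF pos.graded_borel assms] unfolding plus .
  show "N_derivations N borel_minus = derivations borel_minus"
    using graded_subalgebra.N_derivations_eq_derivations[OF neg.graded_borel assms] unfolding minus .
qed

end

theorem corollary4p3p1:
  fixes A :: "int^'i::finite^'i"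
    and scaleh :: "complex \<Rightarrow> 'h::ab_group_add \<Rightarrow> 'h"
    and root :: "'i \<Rightarrow> 'h \<Rightarrow> complex"
    and coroot :: "'i \<Rightarrow> 'h"
    and scale :: "complex \<Rightarrow> 'g::ab_group_add \<Rightarrow> 'g"
    and bracket :: "'g \<Rightarrow> 'g \<Rightarrow> 'g"
    and \<iota> :: "'h \<Rightarrow> 'g"
    and e f :: "'i \<Rightarrow> 'g"
    and N :: nat
  assumes "kac_moody_algebra A scaleh root coroot scale bracket \<iota> e f"
    and "N \<ge> 3"
  shows "lie_algebra.N_derivations scale bracket N UNIV = lie_algebra.derivations scale bracket UNIV
     \<and> lie_algebra.N_derivations scale bracket N (kac_moody_algebra.borel_plus root scale bracket \<iota>)
       = lie_algebra.derivations scale bracket (kac_moody_algebra.borel_plus root scale bracket \<iota>)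
     \<and> lie_algebra.N_derivations scale bracket N (kac_moody_algebra.borel_minus root scale bracket \<iota>)
       = lie_algebra.derivations scale bracket (kac_moody_algebra.borel_minus root scale bracket \<iota>)"
  using kac_moody_algebra.N_derivations_eq_derivations[OF assms] by blast

end
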